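(* Let $N\ge2$ and let $\Omega\subset\mathbb{R}^N$ be an open bounded set. Then $$\lim_{|y|\to\infty}\frac{|y|^{N+2s}}{c_{N,s}}P_s(x,y)=\int_\Omega G_s(x,z)\,dz$$ uniformly in $s\in(0,1)$ and $x\in\Omega$.
   Context: $c_{N,s}=\frac{4^s\Gamma(\frac N2+s)}{\Gamma(2-s)\pi^{N/2}}s(1-s)$. $G_s$ is the Green function of the fractional Laplacian $(-\Delta)^s$ in $\Omega$ with zero exterior condition, and $P_s(x,y)=c_{N,s}\int_\Omega\frac{G_s(x,z)}{|z-y|^{N+2s}}dz$ for $x\in\Omega$, $y\in\mathbb{R}^N\setminus\overline\Omega$, is the fractional Poisson kernel. One has $0\le G_s(x,z)\le\kappa_{N,s}|x-z|^{2s-N}$ with $\kappa_{N,s}=\frac{\Gamma(\frac N2-s)}{4^s\pi^{N/2}\Gamma(s)}$. *)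

theory Defs
  imports "HOL-Analysis.Analysis"
begin

text \<open>Normalising constant of the fractional Laplacian.\<close>
definition frac_c :: "nat \<Rightarrow> real \<Rightarrow> real" where
  "frac_c N s = 4 powr s * Gamma (real N / 2 + s) / (Gamma (2 - s) * pi powr (real N / 2)) * s * (1 - s)"

definition frac_space :: "real \<Rightarrow> 'a::euclidean_space set \<Rightarrow> ('a \<Rightarrow> real) \<Rightarrow> bool" where
  "frac_space s \<Omega> \<phi> \<longleftrightarrow>
     \<phi> \<in> borel_measurable lborel \<and> (\<forall>x. x \<notin> \<Omega> \<longrightarrow> \<phi> x = 0) \<and>
     integrable lborel (\<lambda>x. (\<phi> x)\<^sup>2) \<and>
     integrable (lborel \<Otimes>\<^sub>M lborel)
       (\<lambda>(x, y). (\<phi> x - \<phi> y)\<^sup>2 / norm (x - y) powr (real DIM('a) + 2 * s))"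

definition frac_weak_solution :: "real \<Rightarrow> 'a::euclidean_space set \<Rightarrow> ('a \<Rightarrow> real) \<Rightarrow> ('a \<Rightarrow> real) \<Rightarrow> bool" where
  "frac_weak_solution s \<Omega> f u \<longleftrightarrow>
     frac_space s \<Omega> u \<and>
     (\<forall>\<phi>. frac_space s \<Omega> \<phi> \<longrightarrow>
        frac_c DIM('a) s / 2 *
          (\<integral>p. (case p of (x, y) \<Rightarrow> (u x - u y) * (\<phi> x - \<phi> y) / norm (x - y) powr (real DIM('a) + 2 * s))
              \<partial>(lborel \<Otimes>\<^sub>M lborel))
        = (\<integral>x. f x * \<phi> x \<partial>lborel))"

definition frac_green :: "real \<Rightarrow> 'a::euclidean_space set \<Rightarrow> ('a \<Rightarrow> 'a \<Rightarrow> real) \<Rightarrow> bool" where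
  "frac_green s \<Omega> G \<longleftrightarrow>
     (\<forall>x z. x \<notin> \<Omega> \<or> z \<notin> \<Omega> \<longrightarrow> G x z = 0) \<and>
     continuous_on {p. fst p \<in> \<Omega> \<and> snd p \<in> \<Omega> \<and> fst p \<noteq> snd p} (\<lambda>p. G (fst p) (snd p)) \<and>
     (\<forall>x\<in>\<Omega>. set_integrable lborel \<Omega> (G x)) \<and>
     (\<forall>f. continuous_on UNIV f \<and> compact (closure {x. f x \<noteq> 0}) \<and> closure {x. f x \<noteq> 0} \<subseteq> \<Omega>
          \<longrightarrow> frac_weak_solution s \<Omega> f (\<lambda>x. \<integral>z. G x z * f z \<partial>lborel))"

definition frac_poisson :: "real \<Rightarrow> 'a::euclidean_space set \<Rightarrow> ('a \<Rightarrow> 'a \<Rightarrow> real) \<Rightarrow> 'a \<Rightarrow> 'a \<Rightarrow> real" where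
  "frac_poisson s \<Omega> G x y =
     frac_c DIM('a) s * (LINT z:\<Omega>|lborel. G x z / norm (z - y) powr (real DIM('a) + 2 * s))"

end

theory Submission
  imports Defs
begin

text \<open>
  For \<open>z\<close> in the bounded set \<open>\<Omega>\<close> the ratio \<open>(norm y / norm (z - y)) powr (N + 2 * s)\<close> tends to 1
  uniformly, so everything reduces to a bound on \<open>\<integral> \<bar>G s x z\<bar> dz\<close> that is uniform in \<open>s\<close> and \<open>x\<close>.
  The pointwise bound by the Riesz kernel does not give one, since for \<open>N = 2\<close> its constant blows up
  as \<open>s \<rightarrow> 1\<close>. Instead, the potentials of test functions \<open>f \<le> 1\<close> are compared with a multiple of the
  barrier \<open>w x = max 0 (A\<^sup>2 - (norm x)\<^sup>2)\<close>, where \<open>\<Omega> \<subseteq> cball 0 (A / 2)\<close>: for \<open>x \<in> \<Omega>\<close> the second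
  difference of \<open>w\<close> at \<open>x\<close> with step \<open>h\<close> is at least \<open>2 * min ((norm h)\<^sup>2) 1\<close>, and the integral of
  \<open>min ((norm h)\<^sup>2) 1 / norm h powr (N + 2 * s)\<close> is of exact order \<open>1 / (s * (1 - s))\<close>, which cancels the
  degeneration of \<open>frac_c N s\<close> at both ends. Nonnegativity of \<open>G\<close> comes from the same comparison.
\<close>

section \<open>The Levy kernel\<close>

text \<open>Tonelli: for fixed \<open>t\<close> the points \<open>h\<close> with
  \<open>norm h \<le> t\<close> fill a ball. This makes a radial integral one-dimensional without
  polar coordinates.\<close>

lemma nn_integral_radial_layer_cake:
  fixes D :: "real \<Rightarrow> ennreal"
  assumes [measurable]: "D \<in> borel_measurable borel"
  shows "(\<integral>\<^sup>+ h. (\<integral>\<^sup>+ t. D t * indicator {norm h..} t \<partial>lborel) \<partial>(lborel :: 'a::euclidean_space measure))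
       = (\<integral>\<^sup>+ t. D t * emeasure lborel (cball (0::'a) t) \<partial>lborel)"
proof -
  have [measurable]: "{p::real \<times> 'a. norm (snd p) \<le> fst p} \<in> sets (borel \<Otimes>\<^sub>M borel)"
    by (subst borel_prod) (intro borel_closed closed_Collect_le continuous_intros)
  have "(\<integral>\<^sup>+ h. (\<integral>\<^sup>+ t. D t * indicator {norm h..} t \<partial>lborel) \<partial>(lborel :: 'a measure))
      = (\<integral>\<^sup>+ h. (\<integral>\<^sup>+ t. D t * indicator {p::real \<times> 'a. norm (snd p) \<le> fst p} (t, h) \<partial>lborel) \<partial>lborel)"
    by (intro nn_integral_cong) (auto simp: indicator_def)
  also have "\<dots> = (\<integral>\<^sup>+ t. (\<integral>\<^sup>+ h. D t * indicator {p::real \<times> 'a. norm (snd p) \<le> fst p} (t, h) \<partial>lborel) \<partial>lborel)"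
    by (subst lborel_pair.Fubini') measurable
  also have "\<dots> = (\<integral>\<^sup>+ t. (\<integral>\<^sup>+ h. D t * indicator (cball (0::'a) t) h \<partial>lborel) \<partial>lborel)"
    by (intro nn_integral_cong) (auto simp: indicator_def)
  also have "\<dots> = (\<integral>\<^sup>+ t. D t * emeasure lborel (cball (0::'a) t) \<partial>lborel)"
    by (intro nn_integral_cong) (simp add: nn_integral_cmult_indicator)
  finally show ?thesis .
qed

text \<open>The numerator is the usual weight in the integrability condition for Levy measures. It
  tames the singularity at 0 and matches the second-difference bound of the barrier.\<close>

definition levy_kernel :: "real \<Rightarrow> 'a::euclidean_space \<Rightarrow> real" where
  "levy_kernel s h = min ((norm h)\<^sup>2) 1 / norm h powr (real DIM('a) + 2 * s)"

text \<open>This is the integral of \<open>levy_kernel\<close>. The summands in the bracket belong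
  to the layers \<open>t \<le> 1\<close> and \<open>t \<ge> 1\<close>; they differ by -1 and +1 from
  \<open>N / (2 - 2 * s)\<close> and \<open>N / (2 * s)\<close>, which splitting at the unit sphere
  would give.\<close>

definition levy_mass :: "nat \<Rightarrow> real \<Rightarrow> real" where
  "levy_mass N s = unit_ball_vol N * ((N + 2 * s - 2) / (2 - 2 * s) + (N + 2 * s) / (2 * s))"

lemma levy_kernel_nonneg: "levy_kernel s h \<ge> 0"
  by (simp add: levy_kernel_def)

lemma levy_kernel_measurable [measurable]: "levy_kernel s \<in> borel_measurable borel"
  unfolding levy_kernel_def by measurable

text \<open>After the layer cake only \<open>t powr (1 - 2 * s)\<close> near 0 and
  \<open>t powr (- 2 * s - 1)\<close> near infinity remain, both integrable for
  \<open>0 < s < 1\<close>.\<close>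

lemma nn_integral_levy_kernel:
  assumes N: "DIM('a::euclidean_space) \<ge> 2" and s: "0 < s" "s < 1"
  shows "(\<integral>\<^sup>+ h. ennreal (levy_kernel s h) \<partial>(lborel :: 'a measure)) = ennreal (levy_mass DIM('a) s)"
proof -
  define p where "p = real DIM('a) + 2 * s"
  have p: "p > 2" using N s by (simp add: p_def)
  \<comment> \<open>The radial profile of the kernel is decreasing, so it is the integral over \<open>[norm h, \<infinity>)\<close> of
    \<open>D1 + D2\<close>, minus its derivative.\<close>
  define D1 where "D1 = (\<lambda>t::real. ennreal ((p - 2) * t powr (1 - p)) * indicator {0..1} t)"
  define D2 where "D2 = (\<lambda>t::real. ennreal (p * t powr (- p - 1)) * indicator {1..} t)"
  have [measurable]: "D1 \<in> borel_measurable borel" "D2 \<in> borel_measurable borel"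
    unfolding D1_def D2_def by measurable
  have layer: "(\<integral>\<^sup>+ t. (D1 t + D2 t) * indicator {norm h..} t \<partial>lborel) = ennreal (levy_kernel s h)"
    if "h \<noteq> 0" for h :: 'a
  proof -
    define r where "r = norm h"
    have r: "r > 0" using that by (simp add: r_def)
    have i1: "(\<integral>\<^sup>+ t. D1 t * indicator {r..} t \<partial>lborel) = ennreal (if r < 1 then r powr (2 - p) - 1 else 0)"
    proof (cases "r < 1")
      case True
      have "((\<lambda>t. (p - 2) * t powr (1 - p)) has_integral (- (1 powr (2 - p)) - (- (r powr (2 - p))))) {r..1}"
        using True r p
        by (intro fundamental_theorem_of_calculus)
           (auto intro!: derivative_eq_intros simp: algebra_simps has_real_derivative_iff_has_vector_derivative[symmetric])
      then have "(\<integral>\<^sup>+ t. ennreal ((p - 2) * t powr (1 - p)) * indicator {r..1} t \<partial>lborel)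
          = ennreal (- (1 powr (2 - p)) - (- (r powr (2 - p))))"
        using p by (intro nn_integral_has_integral_lebesgue') auto
      moreover have "(\<integral>\<^sup>+ t. D1 t * indicator {r..} t \<partial>lborel)
          = (\<integral>\<^sup>+ t. ennreal ((p - 2) * t powr (1 - p)) * indicator {r..1} t \<partial>lborel)"
        using r by (intro nn_integral_cong) (auto simp: D1_def indicator_def)
      ultimately show ?thesis using True by simp
    next
      case False
      \<comment> \<open>For \<open>r = 1\<close> the two supports still meet in the point 1, hence
        equality only almost everywhere.\<close>
      have "(\<integral>\<^sup>+ t. D1 t * indicator {r..} t \<partial>lborel) = (\<integral>\<^sup>+ t. 0 \<partial>(lborel::real measure))"
        using False by (intro nn_integral_cong_AE eventually_mono[OF AE_lborel_singleton[of 1]])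
           (auto simp: D1_def indicator_def)
      then show ?thesis using False by simp
    qed
    have i2: "(\<integral>\<^sup>+ t. D2 t * indicator {r..} t \<partial>lborel) = ennreal (max r 1 powr (- p))"
    proof -
      have "((\<lambda>t. t powr (- p - 1)) has_integral (- (max r 1 powr (- p - 1 + 1)) / (- p - 1 + 1))) {max r 1..}"
        using p by (intro has_integral_powr_to_inf) auto
      from has_integral_mult_right[OF this, of p]
      have "((\<lambda>t. p * t powr (- p - 1)) has_integral (max r 1 powr (- p))) {max r 1..}"
        using p by simp
      then have "(\<integral>\<^sup>+ t. ennreal (p * t powr (- p - 1)) * indicator {max r 1..} t \<partial>lborel)
          = ennreal (max r 1 powr (- p))"
        using p by (intro nn_integral_has_integral_lebesgue') auto
      moreover have "(\<integral>\<^sup>+ t. D2 t * indicator {r..} t \<partial>lborel)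
          = (\<integral>\<^sup>+ t. ennreal (p * t powr (- p - 1)) * indicator {max r 1..} t \<partial>lborel)"
        using r by (intro nn_integral_cong) (auto simp: D2_def indicator_def)
      ultimately show ?thesis by simp
    qed
    have "(\<integral>\<^sup>+ t. (D1 t + D2 t) * indicator {r..} t \<partial>lborel)
        = ennreal (if r < 1 then r powr (2 - p) - 1 else 0) + ennreal (max r 1 powr (- p))"
      unfolding i1[symmetric] i2[symmetric] by (subst nn_integral_add[symmetric]) (auto simp: distrib_right)
    also have "\<dots> = ennreal ((if r < 1 then r powr (2 - p) - 1 else 0) + max r 1 powr (- p))"
    proof (rule ennreal_plus[symmetric])
      have "1 \<le> r powr (2 - p)" if "r < 1" using that r p
        using powr_mono'[of "2 - p" 0 r] by simp
      then show "0 \<le> (if r < 1 then r powr (2 - p) - 1 else 0)" by auto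
    qed auto
    also have "(if r < 1 then r powr (2 - p) - 1 else 0) + max r 1 powr (- p) = levy_kernel s h"
    proof (cases "r < 1")
      case True
      then have "min (r\<^sup>2) 1 = r powr 2" using r by (simp add: power_le_one_iff abs_square_le_1 min_def)
      then show ?thesis using True r
        by (simp add: levy_kernel_def flip: r_def p_def) (simp add: powr_diff)
    next
      case False
      then have "min (r\<^sup>2) 1 = 1" using one_le_power[of r 2] by simp
      then show ?thesis using False r
        by (simp add: levy_kernel_def powr_minus max_def divide_inverse flip: r_def p_def)
    qed
    finally show ?thesis by (simp add: r_def)
  qed
  let ?V = "unit_ball_vol (real DIM('a))" and ?N = "DIM('a)"
  have V: "?V \<ge> 0" by simp
  \<comment> \<open>The point \<open>h = 0\<close> has to be left out: there the kernel is 0 by the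
    convention for division, while the layer integral is infinite.\<close>
  have "(\<integral>\<^sup>+ h. ennreal (levy_kernel s h) \<partial>(lborel :: 'a measure))
      = (\<integral>\<^sup>+ h. (\<integral>\<^sup>+ t. (D1 t + D2 t) * indicator {norm h..} t \<partial>lborel) \<partial>(lborel :: 'a measure))"
    by (intro nn_integral_cong_AE eventually_mono[OF AE_lborel_singleton[of 0]]) (simp add: layer)
  also have "\<dots> = (\<integral>\<^sup>+ t. (D1 t + D2 t) * emeasure lborel (cball (0::'a) t) \<partial>lborel)"
    by (intro nn_integral_radial_layer_cake) measurable
  also have "\<dots> = (\<integral>\<^sup>+ t. ennreal ((p - 2) * ?V * t powr (1 - 2 * s)) * indicator {0..1} t
                      + ennreal (p * ?V * t powr (- 2 * s - 1)) * indicator {1..} t \<partial>lborel)"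
  proof (intro nn_integral_cong_AE eventually_mono[OF AE_lborel_singleton[of 0]])
    fix t :: real assume "t \<noteq> 0"
    show "(D1 t + D2 t) * emeasure lborel (cball (0::'a) t) =
      ennreal ((p - 2) * ?V * t powr (1 - 2 * s)) * indicator {0..1} t
                      + ennreal (p * ?V * t powr (- 2 * s - 1)) * indicator {1..} t"
    proof (cases "t < 0")
      case True then show ?thesis by (simp add: D1_def D2_def)
    next
      case False
      then have t: "t > 0" using \<open>t \<noteq> 0\<close> by simp
      have e: "emeasure lborel (cball (0::'a) t) = ennreal (?V * t powr real ?N)"
        using t by (simp add: emeasure_cball powr_realpow)
      have a: "t powr (1 - p) * t powr real ?N = t powr (1 - 2 * s)"
        "t powr (- p - 1) * t powr real ?N = t powr (- 2 * s - 1)"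
        by (simp_all add: p_def flip: powr_add)
      have b: "ennreal ((p - 2) * t powr (1 - p)) * ennreal (?V * t powr real ?N)
          = ennreal ((p - 2) * ?V * t powr (1 - 2 * s))"
        using p V unfolding a(1)[symmetric] by (subst ennreal_mult[symmetric]) (auto simp: mult_ac)
      have c: "ennreal (p * t powr (- p - 1)) * ennreal (?V * t powr real ?N)
          = ennreal (p * ?V * t powr (- 2 * s - 1))"
        using p V unfolding a(2)[symmetric] by (subst ennreal_mult[symmetric]) (auto simp: mult_ac)
      show ?thesis unfolding e D1_def D2_def b[symmetric] c[symmetric]
        by (simp add: indicator_def distrib_right)
    qed
  qed
  also have "\<dots> = ennreal ((p - 2) * ?V * (1 / (2 - 2 * s))) + ennreal (p * ?V * (1 / (2 * s)))"
  proof -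
    have "((\<lambda>t. t powr (1 - 2 * s)) has_integral (1 powr (1 - 2 * s + 1) / (1 - 2 * s + 1))) {0..1}"
      using s by (intro has_integral_powr_from_0) auto
    then have h1: "((\<lambda>t. t powr (1 - 2 * s)) has_integral (1 / (2 - 2 * s))) {0..1}"
      by simp
    have "((\<lambda>t. t powr (- 2 * s - 1)) has_integral (- (1 powr (- 2 * s - 1 + 1)) / (- 2 * s - 1 + 1))) {1..}"
      using s by (intro has_integral_powr_to_inf) auto
    then have h2: "((\<lambda>t. t powr (- 2 * s - 1)) has_integral (1 / (2 * s))) {1..}"
      by simp
    have "(\<integral>\<^sup>+ t. ennreal ((p - 2) * ?V * t powr (1 - 2 * s)) * indicator {0..1} t \<partial>lborel)
        = ennreal ((p - 2) * ?V * (1 / (2 - 2 * s)))"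
      using p V by (intro nn_integral_has_integral_lebesgue' has_integral_mult_right h1) auto
    moreover have "(\<integral>\<^sup>+ t. ennreal (p * ?V * t powr (- 2 * s - 1)) * indicator {1..} t \<partial>lborel)
        = ennreal (p * ?V * (1 / (2 * s)))"
      using p V by (intro nn_integral_has_integral_lebesgue' has_integral_mult_right h2) auto
    ultimately show ?thesis by (subst nn_integral_add) auto
  qed
  also have "\<dots> = ennreal ((p - 2) * ?V * (1 / (2 - 2 * s)) + p * ?V * (1 / (2 * s)))"
    using p s V by (intro ennreal_plus[symmetric]) auto
  also have "(p - 2) * ?V * (1 / (2 - 2 * s)) + p * ?V * (1 / (2 * s)) = levy_mass DIM('a) s"
    unfolding levy_mass_def p_def by (simp only: distrib_left) (simp add: mult.commute)
  finally show ?thesis .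
qed

text \<open>The -1 and +1 contained in the two summands cancel, and
  \<open>1 / (1 - s) + 1 / s = 1 / (s * (1 - s))\<close>.\<close>

lemma levy_mass_eq:
  assumes "0 < s" "s < 1"
  shows "s * (1 - s) * levy_mass N s = unit_ball_vol N * N / 2"
  unfolding levy_mass_def using assms by (simp add: divide_simps) (simp add: algebra_simps)

section \<open>Lower bound for the normalising constant times the Levy mass\<close>

lemma frac_c_pos:
  assumes "0 < s" "s < 1"
  shows "frac_c N s > 0"
  unfolding frac_c_def using assms
  by (intro mult_pos_pos divide_pos_pos Gamma_real_pos) auto

text \<open>Without its factor \<open>s * (1 - s)\<close> the constant \<open>frac_c N s\<close>
  becomes \<open>g s\<close>, which is continuous and positive on the closed interval
  \<open>{0..1}\<close> and so attains a positive minimum. The factor removed turns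
  \<open>levy_mass\<close> into a constant.\<close>

lemma frac_c_levy_mass_lower:
  assumes N: "N \<ge> 2"
  obtains \<kappa> where "\<kappa> > 0" "\<And>s. 0 < s \<Longrightarrow> s < 1 \<Longrightarrow> frac_c N s * levy_mass N s \<ge> \<kappa>"
proof -
  define g where "g s = 4 powr s * Gamma (real N / 2 + s) / (Gamma (2 - s) * pi powr (real N / 2))" for s
  have pos: "g s > 0" if "s \<in> {0..1}" for s
    unfolding g_def using that N
    by (intro mult_pos_pos divide_pos_pos Gamma_real_pos) auto
  have np: "x \<notin> \<int>\<^sub>\<le>\<^sub>0" if "x > 0" for x :: real
    using that nonpos_Ints_nonpos by fastforce
  have "continuous_on {0..1} g"
    unfolding g_def using N
    by (intro continuous_intros continuous_on_compose2[OF continuous_on_Gamma[of "{0<..}"]])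
       (auto simp: np intro!: less_imp_neq[symmetric] mult_pos_pos Gamma_real_pos)
  then obtain s0 where s0: "s0 \<in> {0..1}" "\<And>s. s \<in> {0..1} \<Longrightarrow> g s0 \<le> g s"
    using continuous_attains_inf[of "{0..1::real}" g] by auto
  show ?thesis
  proof
    show "g s0 * (unit_ball_vol N * N / 2) > 0"
      using pos[OF s0(1)] N by simp
    fix s :: real assume s: "0 < s" "s < 1"
    have "g s0 * (unit_ball_vol N * N / 2) \<le> g s * (s * (1 - s) * levy_mass N s)"
      using s0(2)[of s] levy_mass_eq[OF s] pos[of s] s
      by (intro mult_mono) auto
    also have "\<dots> = frac_c N s * levy_mass N s"
      by (simp add: frac_c_def g_def)
    finally show "g s0 * (unit_ball_vol N * N / 2) \<le> frac_c N s * levy_mass N s" .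
  qed
qed

section \<open>The energy form\<close>

lemma lborel_distr_reflect: "distr lborel borel (\<lambda>y. x - y) = (lborel :: 'a::euclidean_space measure)"
  using lborel_affine[of "-1" x] by (simp add: density_1)

lemma integrable_lborel_reflect:
  fixes g :: "'a::euclidean_space \<Rightarrow> real"
  assumes "integrable lborel g"
  shows "integrable lborel (\<lambda>y. g (x - y))"
proof -
  have "integrable (distr lborel borel (\<lambda>y. x - y)) g"
    using assms by (simp add: lborel_distr_reflect)
  then show ?thesis by (subst (asm) integrable_distr_eq) (use assms in auto)
qed

lemma integral_lborel_reflect:
  fixes g :: "'a::euclidean_space \<Rightarrow> real"
  assumes "g \<in> borel_measurable borel"
  shows "(\<integral>y. g (x - y) \<partial>lborel) = (\<integral>y. g y \<partial>lborel)"
proof -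
  have "(\<integral>y. g y \<partial>lborel) = (\<integral>y. g y \<partial>distr lborel borel (\<lambda>y. x - y))"
    by (simp add: lborel_distr_reflect)
  also have "\<dots> = (\<integral>y. g (x - y) \<partial>lborel)"
    using assms by (intro integral_distr) auto
  finally show ?thesis by simp
qed

text \<open>Integrating the modulus over \<open>y\<close> gives \<open>\<bar>g x\<bar>\<close> times
  the L1 norm of \<open>k\<close>. Serves as the dominating function both for the truncated form and
  for the energy of the barrier.\<close>

lemma integrable_convolution_integrand:
  fixes g k :: "'a::euclidean_space \<Rightarrow> real"
  assumes g: "integrable lborel g" and k: "integrable lborel k"
  shows "integrable (lborel \<Otimes>\<^sub>M lborel) (\<lambda>(x, y). g x * k (x - y))"
proof -
  have [measurable]: "g \<in> borel_measurable borel" "k \<in> borel_measurable borel"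
    using g k by (auto dest: borel_measurable_integrable)
  show ?thesis
  proof (rule lborel_pair.Fubini_integrable)
    have "(\<integral>y. norm (g x * k (x - y)) \<partial>lborel) = \<bar>g x\<bar> * (\<integral>y. \<bar>k y\<bar> \<partial>lborel)" for x
      using integral_lborel_reflect[of "\<lambda>y. \<bar>k y\<bar>" x] by (simp add: abs_mult)
    then show "integrable lborel (\<lambda>x. \<integral>y. norm (case (x, y) of (x, y) \<Rightarrow> g x * k (x - y)) \<partial>lborel)"
      using g by simp
    show "AE x in lborel. integrable lborel (\<lambda>y. case (x, y) of (x, y) \<Rightarrow> g x * k (x - y))"
      using integrable_lborel_reflect[OF k] by simp
  qed measurable
qed

lemma
  assumes "DIM('a::euclidean_space) \<ge> 2" "0 < s" "s < 1"
  shows integrable_levy_kernel: "integrable lborel (levy_kernel s :: 'a \<Rightarrow> real)"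
    and integral_levy_kernel: "(\<integral>h. levy_kernel s h \<partial>(lborel :: 'a measure)) = levy_mass DIM('a) s"
proof -
  have "levy_mass DIM('a) s \<ge> 0"
    unfolding levy_mass_def using assms by auto
  then have "has_bochner_integral lborel (levy_kernel s :: 'a \<Rightarrow> real) (levy_mass DIM('a) s)"
    using nn_integral_levy_kernel[OF assms]
    by (intro has_bochner_integral_nn_integral) (auto simp: levy_kernel_nonneg)
  then show "integrable lborel (levy_kernel s :: 'a \<Rightarrow> real)"
    "(\<integral>h. levy_kernel s h \<partial>(lborel :: 'a measure)) = levy_mass DIM('a) s"
    by (auto simp: has_bochner_integral_iff)
qed

text \<open>Integrand of the bilinear form in \<open>frac_weak_solution\<close>; for
  \<open>u = v\<close> it is that of the squared Gagliardo seminorm. It vanishes on the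
  diagonal.\<close>

definition gagliardo :: "real \<Rightarrow> ('a::euclidean_space \<Rightarrow> real) \<Rightarrow> ('a \<Rightarrow> real) \<Rightarrow> 'a \<times> 'a \<Rightarrow> real" where
  "gagliardo s u v = (\<lambda>(x, y). (u x - u y) * (v x - v y) / norm (x - y) powr (real DIM('a) + 2 * s))"

lemma gagliardo_measurable [measurable]:
  assumes [measurable]: "u \<in> borel_measurable borel" "v \<in> borel_measurable borel"
  shows "gagliardo s u v \<in> borel_measurable (lborel \<Otimes>\<^sub>M lborel)"
  unfolding gagliardo_def by measurable

text \<open>Pointwise \<open>\<bar>a * b\<bar> \<le> a * a + b * b\<close> for the two increments,
  over a common denominator.\<close>

lemma integrable_gagliardo:
  fixes u v :: "'a::euclidean_space \<Rightarrow> real"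
  assumes [measurable]: "u \<in> borel_measurable borel" "v \<in> borel_measurable borel"
    and "integrable (lborel \<Otimes>\<^sub>M lborel) (gagliardo s u u)"
    and "integrable (lborel \<Otimes>\<^sub>M lborel) (gagliardo s v v)"
  shows "integrable (lborel \<Otimes>\<^sub>M lborel) (gagliardo s u v)"
proof (rule Bochner_Integration.integrable_bound[OF Bochner_Integration.integrable_add[OF assms(3,4)]])
  have ab: "\<bar>a * b\<bar> \<le> a * a + b * b" for a b :: real
  proof -
    have "0 \<le> (\<bar>a\<bar> - \<bar>b\<bar>)\<^sup>2" by simp
    then have "2 * \<bar>a * b\<bar> \<le> a * a + b * b"
      by (simp add: power2_diff abs_mult) (simp add: power2_eq_square)
    then show ?thesis by linarith
  qed
  have "\<bar>gagliardo s u v p\<bar> \<le> \<bar>gagliardo s u u p + gagliardo s v v p\<bar>" for p :: "'a \<times> 'a"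
    unfolding gagliardo_def case_prod_beta add_divide_distrib[symmetric]
    using ab[of "u (fst p) - u (snd p)" "v (fst p) - v (snd p)"]
    by (simp add: divide_right_mono)
  then show "AE p in lborel \<Otimes>\<^sub>M lborel. norm (gagliardo s u v p) \<le> norm (gagliardo s u u p + gagliardo s v v p)"
    by simp
qed measurable

text \<open>Pointwise convergence for removing the cut-off. The first hypothesis covers
  \<open>d = 0\<close>, the diagonal, where the cut-off is active for every
  \<open>n\<close>.\<close>

lemma tendsto_indicator_gt_inverse:
  fixes c d :: real
  assumes "d = 0 \<Longrightarrow> c = 0" "d \<ge> 0"
  shows "(\<lambda>n. if inverse (real (Suc n)) < d then c else 0) \<longlonglongrightarrow> c"
proof (cases "d = 0")
  case False
  then have "eventually (\<lambda>n. inverse (real (Suc n)) < d) sequentially"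
    using assms by (intro order_tendstoD(2)[OF LIMSEQ_inverse_real_of_nat]) auto
  then show ?thesis
    by (intro tendsto_eventually) (rule eventually_mono, assumption, simp)
qed (use assms in simp)

text \<open>
  The second-difference bound says that \<open>w\<close> is a strict supersolution. Away from the diagonal the
  energy form can be symmetrised into an integral of \<open>\<phi>\<close> against second differences of \<open>w\<close>;
  the cut-off \<open>norm (x - y) > d n\<close> is then removed by dominated convergence.
\<close>
lemma gagliardo_lower_bound:
  fixes w \<phi> :: "'a::euclidean_space \<Rightarrow> real"
  assumes N: "DIM('a) \<ge> 2" and s: "0 < s" "s < 1"
    and [measurable]: "w \<in> borel_measurable borel" and B: "\<And>x. \<bar>w x\<bar> \<le> B"
    and \<phi>: "integrable lborel \<phi>" "\<And>x. \<phi> x \<ge> 0" "\<And>x. x \<notin> \<Omega> \<Longrightarrow> \<phi> x = 0"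
    and w: "\<And>x h. x \<in> \<Omega> \<Longrightarrow> 2 * w x - w (x + h) - w (x - h) \<ge> 2 * min ((norm h)\<^sup>2) 1"
    and int: "integrable (lborel \<Otimes>\<^sub>M lborel) (gagliardo s w \<phi>)"
  shows "2 * levy_mass DIM('a) s * (\<integral>x. \<phi> x \<partial>lborel) \<le> (\<integral>p. gagliardo s w \<phi> p \<partial>(lborel \<Otimes>\<^sub>M lborel))"
proof -
  define d where "d n = inverse (real (Suc n))" for n
  have d: "0 < d n" "d n \<le> 1" for n by (auto simp: d_def field_simps)
  define k where "k n h = (if d n < norm h then 1 / norm h powr (real DIM('a) + 2 * s) else 0)" for n and h :: 'a
  define j where "j n = (\<integral>h. min ((norm h)\<^sup>2) 1 * k n h \<partial>(lborel :: 'a measure))" for n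
  have [measurable]: "\<phi> \<in> borel_measurable borel" using \<phi>(1) by (auto dest: borel_measurable_integrable)
  have [measurable]: "k n \<in> borel_measurable borel" for n unfolding k_def by measurable
  have k0: "0 \<le> k n h" for n h by (simp add: k_def)
  have kminus: "k n (- h) = k n h" for n h by (simp add: k_def)
  have ksym: "k n (x - y) = k n (y - x)" for n x y by (simp add: k_def norm_minus_commute)
  have lk: "integrable lborel (levy_kernel s :: 'a \<Rightarrow> real)"
    by (rule integrable_levy_kernel[OF N s])
  have kint: "integrable lborel (k n)" for n
  proof (rule Bochner_Integration.integrable_bound)
    show "integrable lborel (\<lambda>h::'a. levy_kernel s h / (d n)\<^sup>2)" using lk by simp
    \<comment> \<open>Where \<open>k n\<close> is nonzero, \<open>min ((norm h)\<^sup>2) 1\<close>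
      is at least \<open>(d n)\<^sup>2\<close>, since \<open>d n \<le> 1\<close>.\<close>
    have "k n h \<le> levy_kernel s h / (d n)\<^sup>2" for h
    proof (cases "d n < norm h")
      case True
      then have "(d n)\<^sup>2 \<le> min ((norm h)\<^sup>2) 1"
        using d[of n] by (auto intro!: power_mono simp: power_le_one)
      then have "1 \<le> min ((norm h)\<^sup>2) 1 / (d n)\<^sup>2"
        using d(1)[of n] by (simp add: field_simps)
      then have "1 / norm h powr (real DIM('a) + 2 * s) \<le>
          (min ((norm h)\<^sup>2) 1 / (d n)\<^sup>2) / norm h powr (real DIM('a) + 2 * s)"
        by (intro divide_right_mono) auto
      then show ?thesis using True by (simp add: k_def levy_kernel_def mult.commute)
    qed (simp add: k_def levy_kernel_nonneg)
    then show "AE h in lborel. norm (k n h) \<le> norm (levy_kernel s h / (d n)\<^sup>2)"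
      using k0 by (simp add: abs_of_nonneg[OF levy_kernel_nonneg])
  qed measurable
  have mk: "min ((norm h)\<^sup>2) 1 * k n h = (if d n < norm h then levy_kernel s h else 0)" for n and h :: 'a
    by (simp add: k_def levy_kernel_def)
  have jlim: "j \<longlonglongrightarrow> levy_mass DIM('a) s"
    unfolding j_def mk integral_levy_kernel[OF N s, symmetric]
  proof (rule integral_dominated_convergence[OF _ _ lk])
    show "AE h in lborel. (\<lambda>n. if d n < norm h then levy_kernel s h else 0) \<longlonglongrightarrow> levy_kernel s (h :: 'a)"
      unfolding d_def by (intro AE_I2 tendsto_indicator_gt_inverse) (auto simp: levy_kernel_def)
  qed (auto simp: levy_kernel_nonneg)
  define F where "F n = (\<lambda>(x, y). (w x - w y) * (\<phi> x - \<phi> y) * k n (x - y))" for n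
  \<comment> \<open>\<open>A n\<close> is the half of \<open>F n\<close> that carries
    \<open>\<phi> x\<close>; as \<open>k n\<close> is even, exchanging the variables gives the other
    half. The cut-off makes each half integrable, which may fail for the full kernel.\<close>
  define A where "A n = (\<lambda>(x, y). (w x - w y) * \<phi> x * k n (x - y))" for n
  have Feq: "F n p = (if d n < norm (fst p - snd p) then gagliardo s w \<phi> p else 0)" for n p
    by (simp add: F_def gagliardo_def k_def case_prod_beta)
  have Flim: "(\<lambda>n. \<integral>p. F n p \<partial>(lborel \<Otimes>\<^sub>M lborel)) \<longlonglongrightarrow> (\<integral>p. gagliardo s w \<phi> p \<partial>(lborel \<Otimes>\<^sub>M lborel))"
  proof (rule integral_dominated_convergence[OF _ _ integrable_norm[OF int]])
    show "AE p in lborel \<Otimes>\<^sub>M lborel. (\<lambda>n. F n p) \<longlonglongrightarrow> gagliardo s w \<phi> p"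
      unfolding Feq d_def
      by (intro AE_I2 tendsto_indicator_gt_inverse) (auto simp: gagliardo_def case_prod_beta)
    show "F n \<in> borel_measurable (lborel \<Otimes>\<^sub>M lborel)" for n
      unfolding F_def by measurable
  qed (auto simp: Feq)
  have Bpos: "B \<ge> 0" using B[of 0] by linarith
  have Aint: "integrable (lborel \<Otimes>\<^sub>M lborel) (A n)" for n
  proof (rule Bochner_Integration.integrable_bound)
    show "integrable (lborel \<Otimes>\<^sub>M lborel) (\<lambda>p. 2 * B * (case p of (x, y) \<Rightarrow> \<phi> x * k n (x - y)))"
      using integrable_convolution_integrand[OF \<phi>(1) kint[of n]] by simp
    show "A n \<in> borel_measurable (lborel \<Otimes>\<^sub>M lborel)"
      unfolding A_def by measurable
    have "\<bar>(w x - w y) * \<phi> x * k n (x - y)\<bar> \<le> \<bar>2 * B * (\<phi> x * k n (x - y))\<bar>" for x y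
    proof -
      have "\<bar>w x - w y\<bar> \<le> 2 * B" using B[of x] B[of y] by linarith
      then have "\<bar>w x - w y\<bar> * (\<phi> x * k n (x - y)) \<le> 2 * B * (\<phi> x * k n (x - y))"
        using \<phi>(2)[of x] k0[of n "x - y"] by (intro mult_right_mono) auto
      then show ?thesis using \<phi>(2)[of x] k0[of n "x - y"] Bpos
        by (simp add: abs_mult mult.assoc)
    qed
    then show "AE p in lborel \<Otimes>\<^sub>M lborel. norm (A n p) \<le> norm (2 * B * (case p of (x, y) \<Rightarrow> \<phi> x * k n (x - y)))"
      by (simp add: A_def case_prod_beta)
  qed
  have Aval: "j n * (\<integral>x. \<phi> x \<partial>lborel) \<le> (\<integral>p. A n p \<partial>(lborel \<Otimes>\<^sub>M lborel))" for n
  proof -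
    \<comment> \<open>Used with \<open>c = 1\<close> and \<open>c = -1\<close>, the two sides of the
      second difference.\<close>
    have wk: "integrable lborel (\<lambda>h. (w x - w (x + c *\<^sub>R h)) * k n h)" for x c
    proof (rule Bochner_Integration.integrable_bound)
      show "integrable lborel (\<lambda>h. 2 * B * k n h)" using kint by simp
      have "\<bar>(w x - w (x + c *\<^sub>R h)) * k n h\<bar> \<le> \<bar>2 * B * k n h\<bar>" for h
      proof -
        have "\<bar>w x - w (x + c *\<^sub>R h)\<bar> \<le> 2 * B" using B[of x] B[of "x + c *\<^sub>R h"] by linarith
        then show ?thesis using k0[of n h] Bpos by (simp add: abs_mult mult_right_mono)
      qed
      then show "AE h in lborel. norm ((w x - w (x + c *\<^sub>R h)) * k n h) \<le> norm (2 * B * k n h)" by simp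
    qed measurable
    \<comment> \<open>Substituting \<open>y = x - h\<close> and then \<open>h\<close> by
      \<open>-h\<close> writes the integral in two ways; their sum contains the second difference of
      \<open>w\<close> at \<open>x\<close>.\<close>
    have inner: "j n \<le> (\<integral>y. (w x - w y) * k n (x - y) \<partial>lborel)" if x: "x \<in> \<Omega>" for x
    proof -
      have e1: "(\<integral>y. (w x - w y) * k n (x - y) \<partial>lborel) = (\<integral>h. (w x - w (x - h)) * k n h \<partial>lborel)"
        using integral_lborel_reflect[of "\<lambda>h. (w x - w (x - h)) * k n h" x] by simp
      have e2: "(\<integral>h. (w x - w (x - h)) * k n h \<partial>lborel) = (\<integral>h. (w x - w (x + h)) * k n h \<partial>lborel)"
        using integral_lborel_reflect[of "\<lambda>h. (w x - w (x + h)) * k n h" 0] by (simp add: kminus)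
      have "2 * j n = (\<integral>h. 2 * (min ((norm h)\<^sup>2) 1 * k n h) \<partial>lborel)"
        by (simp add: j_def)
      also have "\<dots> \<le> (\<integral>h. (w x - w (x - h)) * k n h + (w x - w (x + h)) * k n h \<partial>lborel)"
      proof (rule integral_mono)
        show "integrable lborel (\<lambda>h. 2 * (min ((norm h)\<^sup>2) 1 * k n h))"
        proof (intro integrable_mult_right Bochner_Integration.integrable_bound[OF kint[of n]])
          show "AE h in lborel. norm (min ((norm h)\<^sup>2) 1 * k n h) \<le> norm (k n h)"
            using k0 by (intro AE_I2) (auto simp: abs_mult mult_left_le_one_le)
        qed measurable
        show "integrable lborel (\<lambda>h. (w x - w (x - h)) * k n h + (w x - w (x + h)) * k n h)"
          using wk[of x "-1"] wk[of x 1] by simp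
        fix h
        have "2 * min ((norm h)\<^sup>2) 1 * k n h \<le> (2 * w x - w (x + h) - w (x - h)) * k n h"
          using w[OF x, of h] k0[of n h] by (rule mult_right_mono)
        then show "2 * (min ((norm h)\<^sup>2) 1 * k n h) \<le> (w x - w (x - h)) * k n h + (w x - w (x + h)) * k n h"
          by (simp add: algebra_simps)
      qed
      also have "\<dots> = 2 * (\<integral>h. (w x - w (x - h)) * k n h \<partial>lborel)"
        using wk[of x "-1"] wk[of x 1] e2 by simp
      finally show ?thesis using e1 by simp
    qed
    have Afst: "integrable lborel (\<lambda>x. \<integral>y. (w x - w y) * \<phi> x * k n (x - y) \<partial>lborel)"
      using lborel_pair.integrable_fst'[OF Aint[of n]] by (simp add: A_def)
    have "j n * (\<integral>x. \<phi> x \<partial>lborel) = (\<integral>x. j n * \<phi> x \<partial>lborel)" by simp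
    also have "\<dots> \<le> (\<integral>x. (\<integral>y. (w x - w y) * \<phi> x * k n (x - y) \<partial>lborel) \<partial>lborel)"
    proof (rule integral_mono[OF _ Afst])
      show "integrable lborel (\<lambda>x. j n * \<phi> x)" using \<phi>(1) by simp
      fix x
      have "(\<integral>y. (w x - w y) * \<phi> x * k n (x - y) \<partial>lborel) = \<phi> x * (\<integral>y. (w x - w y) * k n (x - y) \<partial>lborel)"
        by (subst integral_mult_right_zero[symmetric]) (simp add: mult_ac)
      then show "j n * \<phi> x \<le> (\<integral>y. (w x - w y) * \<phi> x * k n (x - y) \<partial>lborel)"
        using inner[of x] \<phi>(2,3)[of x] by (cases "x \<in> \<Omega>") (auto simp: mult.commute mult_left_mono)
    qed
    also have "\<dots> = (\<integral>p. A n p \<partial>(lborel \<Otimes>\<^sub>M lborel))"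
      using lborel_pair.integral_fst'[OF Aint[of n]] by (simp add: A_def)
    finally show ?thesis .
  qed
  have "2 * j n * (\<integral>x. \<phi> x \<partial>lborel) \<le> (\<integral>p. F n p \<partial>(lborel \<Otimes>\<^sub>M lborel))" for n
  proof -
    have sw: "integrable (lborel \<Otimes>\<^sub>M lborel) (\<lambda>(x, y). A n (y, x))"
      using Aint by (rule lborel_pair.integrable_product_swap)
    have "F n = (\<lambda>p. A n p + (case p of (x, y) \<Rightarrow> A n (y, x)))"
      by (auto simp: F_def A_def fun_eq_iff ksym algebra_simps)
    then have "(\<integral>p. F n p \<partial>(lborel \<Otimes>\<^sub>M lborel)) = (\<integral>p. A n p \<partial>(lborel \<Otimes>\<^sub>M lborel)) + (\<integral>(x, y). A n (y, x) \<partial>(lborel \<Otimes>\<^sub>M lborel))"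
      using sw Aint by simp
    also have "(\<integral>(x, y). A n (y, x) \<partial>(lborel \<Otimes>\<^sub>M lborel)) = (\<integral>p. A n p \<partial>(lborel \<Otimes>\<^sub>M lborel))"
      using Aint[of n] by (intro lborel_pair.integral_product_swap) (rule borel_measurable_integrable)
    finally show ?thesis using Aval[of n] by simp
  qed
  moreover have "(\<lambda>n. 2 * j n * (\<integral>x. \<phi> x \<partial>lborel)) \<longlonglongrightarrow> 2 * levy_mass DIM('a) s * (\<integral>x. \<phi> x \<partial>lborel)"
    by (intro tendsto_intros jlim)
  ultimately show ?thesis
    using LIMSEQ_le[OF _ Flim] by blast
qed

section \<open>Barrier and comparison\<close>

lemma norm_mono_nonneg: "0 \<le> a \<Longrightarrow> a \<le> b \<Longrightarrow> norm a \<le> norm (b :: real)"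
  by simp

definition barrier :: "real \<Rightarrow> 'a::euclidean_space \<Rightarrow> real" where
  "barrier A x = max 0 (A\<^sup>2 - (norm x)\<^sup>2)"

lemma barrier_measurable [measurable]: "barrier A \<in> borel_measurable borel"
  unfolding barrier_def by measurable

lemma barrier_nonneg: "barrier A x \<ge> 0" and barrier_le: "barrier A x \<le> A\<^sup>2"
  by (auto simp: barrier_def)

text \<open>Parallelogram law. If neither \<open>x + h\<close> nor \<open>x - h\<close> leaves the
  ball of radius \<open>A\<close>, the second difference is exactly
  \<open>2 * (norm h)\<^sup>2\<close>. Otherwise at most one subtracted term survives, and it is at
  most \<open>A\<^sup>2\<close>, so at least
  \<open>A\<^sup>2 - 2 * (norm x)\<^sup>2 \<ge> A\<^sup>2 / 2 \<ge> 2\<close> remains.\<close>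

lemma barrier_second_difference:
  fixes x h :: "'a::euclidean_space"
  assumes A: "A \<ge> 2" and x: "norm x \<le> A / 2"
  shows "2 * barrier A x - barrier A (x + h) - barrier A (x - h) \<ge> 2 * min ((norm h)\<^sup>2) 1"
proof -
  have par: "(norm (x + h))\<^sup>2 + (norm (x - h))\<^sup>2 = 2 * (norm x)\<^sup>2 + 2 * (norm h)\<^sup>2"
    by (simp add: power2_norm_eq_inner algebra_simps inner_commute)
  have "(norm x)\<^sup>2 \<le> (A / 2)\<^sup>2" using x by (intro power_mono) auto
  moreover have "(2::real)\<^sup>2 \<le> A\<^sup>2" using A by (intro power_mono) auto
  ultimately have "4 * (norm x)\<^sup>2 \<le> A\<^sup>2" "4 \<le> A\<^sup>2" by (auto simp: power_divide)
  moreover have "2 * min t 1 \<le> 2 * max 0 (S - q) - max 0 (S - a) - max 0 (S - b)"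
    if "a + b = 2 * q + 2 * t" "4 * q \<le> S" "4 \<le> S" "a \<ge> 0" "b \<ge> 0" "q \<ge> 0" for a b q t S :: real
    using that by (smt (verit))
  ultimately show ?thesis
    unfolding barrier_def using par by simp
qed

text \<open>The barrier is \<open>A\<^sup>2\<close> minus the square of
  \<open>min (norm x) A\<close>, which is 1-Lipschitz with values in \<open>[0, A]\<close>.\<close>

lemma barrier_lipschitz:
  fixes x y :: "'a::euclidean_space"
  assumes "A \<ge> 0"
  shows "\<bar>barrier A x - barrier A y\<bar> \<le> 2 * A * norm (x - y)"
proof -
  have b: "barrier A z = A\<^sup>2 - (min (norm z) A)\<^sup>2" for z :: 'a
  proof (cases "norm z \<le> A")
    case True
    then have "(norm z)\<^sup>2 \<le> A\<^sup>2" by (intro power_mono) auto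
    then show ?thesis using True by (simp add: barrier_def)
  next
    case False
    then have "A\<^sup>2 \<le> (norm z)\<^sup>2" using assms by (intro power_mono) auto
    then show ?thesis using False by (simp add: barrier_def)
  qed
  define p q where "p = min (norm x) A" and "q = min (norm y) A"
  have pq: "0 \<le> p" "p \<le> A" "0 \<le> q" "q \<le> A" using assms by (auto simp: p_def q_def)
  have "\<bar>barrier A x - barrier A y\<bar> = \<bar>q\<^sup>2 - p\<^sup>2\<bar>"
    by (simp add: b p_def q_def)
  also have "\<dots> = \<bar>q - p\<bar> * (q + p)"
    using pq by (simp add: power2_eq_square square_diff_square_factored abs_mult mult.commute)
  also have "\<dots> \<le> norm (x - y) * (2 * A)"
  proof (rule mult_mono)
    show "\<bar>q - p\<bar> \<le> norm (x - y)"
      using norm_triangle_ineq3[of x y] by (auto simp: p_def q_def min_def)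
  qed (use pq in auto)
  finally show ?thesis by (simp add: mult_ac)
qed

text \<open>The squared increment is at most \<open>C * min ((norm (x - y))\<^sup>2) 1\<close>,
  where \<open>C\<close> adds the squares of the Lipschitz constant \<open>2 * A\<close> and the
  bound \<open>A\<^sup>2\<close>. It vanishes when both points lie outside the ball, so
  \<open>H\<close> and its swap dominate.\<close>

lemma integrable_gagliardo_barrier:
  assumes N: "DIM('a::euclidean_space) \<ge> 2" and s: "0 < s" "s < 1" and A: "A \<ge> 0"
  shows "integrable (lborel \<Otimes>\<^sub>M lborel) (gagliardo s (barrier A) (barrier A :: 'a \<Rightarrow> real))"
proof -
  let ?w = "barrier A :: 'a \<Rightarrow> real"
  define C where "C = 4 * A\<^sup>2 + (A\<^sup>2)\<^sup>2"
  define g where "g = (indicator (cball 0 A) :: 'a \<Rightarrow> real)"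
  define H where "H = (\<lambda>(x, y). g x * levy_kernel s (x - y))"
  have "integrable lborel g"
    unfolding g_def by (intro integrable_real_indicator) (auto simp: emeasure_cball A)
  then have H: "integrable (lborel \<Otimes>\<^sub>M lborel) H"
    unfolding H_def by (rule integrable_convolution_integrand) (rule integrable_levy_kernel[OF N s])
  then have H': "integrable (lborel \<Otimes>\<^sub>M lborel) (\<lambda>(x, y). H (y, x))"
    by (rule lborel_pair.integrable_product_swap)
  have "gagliardo s ?w ?w p \<le> C * (H p + (case p of (x, y) \<Rightarrow> H (y, x)))" for p
  proof -
    obtain x y where p: "p = (x, y)" by (cases p)
    have lk: "levy_kernel s (y - x) = levy_kernel s (x - y)"
      by (simp add: levy_kernel_def norm_minus_commute)
    have le: "(?w x - ?w y)\<^sup>2 \<le> C * min ((norm (x - y))\<^sup>2) 1"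
    proof -
      have "\<bar>?w x - ?w y\<bar>\<^sup>2 \<le> (2 * A * norm (x - y))\<^sup>2"
        by (intro power_mono barrier_lipschitz A) auto
      then have 1: "(?w x - ?w y)\<^sup>2 \<le> 4 * A\<^sup>2 * (norm (x - y))\<^sup>2" by (simp add: power_mult_distrib)
      have "\<bar>?w x - ?w y\<bar>\<^sup>2 \<le> (A\<^sup>2)\<^sup>2"
        using barrier_nonneg[of A x] barrier_nonneg[of A y] barrier_le[of A x] barrier_le[of A y]
        by (intro power_mono) auto
      then have 2: "(?w x - ?w y)\<^sup>2 \<le> (A\<^sup>2)\<^sup>2" by simp
      have "4 * A\<^sup>2 * (norm (x - y))\<^sup>2 \<le> C * (norm (x - y))\<^sup>2" "(A\<^sup>2)\<^sup>2 \<le> C"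
        unfolding C_def by (auto intro: mult_right_mono)
      then show ?thesis using 1 2 by (auto simp: min_def)
    qed
    show ?thesis
    proof (cases "x \<in> cball 0 A \<or> y \<in> cball 0 A")
      case True
      have "gagliardo s ?w ?w p \<le> C * levy_kernel s (x - y)"
        using divide_right_mono[OF le, of "norm (x - y) powr (real DIM('a) + 2 * s)"]
        by (simp add: p gagliardo_def levy_kernel_def power2_eq_square)
      also have "\<dots> \<le> C * (g x * levy_kernel s (x - y) + g y * levy_kernel s (y - x))"
        using True levy_kernel_nonneg[of s "x - y"] unfolding lk
        by (intro mult_left_mono) (auto simp: g_def indicator_def C_def)
      finally show ?thesis by (simp add: p H_def)
    next
      case False
      then have "A\<^sup>2 \<le> (norm x)\<^sup>2" "A\<^sup>2 \<le> (norm y)\<^sup>2"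
        using A by (auto intro!: power_mono)
      then show ?thesis using False
        by (simp add: p gagliardo_def barrier_def H_def g_def)
    qed
  qed
  moreover have "0 \<le> gagliardo s ?w ?w p" for p
    by (auto simp: gagliardo_def case_prod_beta)
  ultimately have "AE p in lborel \<Otimes>\<^sub>M lborel. norm (gagliardo s ?w ?w p) \<le> norm (C * (H p + (case p of (x, y) \<Rightarrow> H (y, x))))"
    by (intro AE_I2 norm_mono_nonneg)
  then show ?thesis
    by (intro Bochner_Integration.integrable_bound[OF integrable_mult_right[OF Bochner_Integration.integrable_add[OF H H']]])
       measurable
qed

section \<open>Comparison principle for weak solutions\<close>

lemma frac_space_iff_gagliardo:
  "frac_space s \<Omega> u \<longleftrightarrow> u \<in> borel_measurable lborel \<and> (\<forall>x. x \<notin> \<Omega> \<longrightarrow> u x = 0) \<and>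
     integrable lborel (\<lambda>x. (u x)\<^sup>2) \<and> integrable (lborel \<Otimes>\<^sub>M lborel) (gagliardo s u u)"
  by (simp add: frac_space_def gagliardo_def power2_eq_square)

text \<open>A nonempty open set contains a ball, which has positive measure.\<close>

lemma AE_lborel_open_Bex:
  fixes c :: "'a::euclidean_space"
  assumes "AE x in lborel. P x" and "open U" "c \<in> U"
  shows "\<exists>x\<in>U. P x"
proof (rule ccontr)
  assume neg: "\<not> (\<exists>x\<in>U. P x)"
  obtain r where r: "r > 0" "ball c r \<subseteq> U" using assms(2,3) openE by blast
  have "AE x in lborel. x \<notin> ball c r"
    using assms(1) by (rule eventually_mono) (use neg r(2) in blast)
  then have "emeasure lborel (ball c r) = 0"
    by (subst (asm) AE_iff_measurable[where N="ball c r"]) auto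
  then show False
    using r(1) unit_ball_vol_pos[of "real DIM('a)"] by (simp add: emeasure_ball)
qed

text \<open>Zero energy forces \<open>\<phi> x = \<phi> y\<close> for almost all pairs, and
  \<open>y\<close> can be taken in a ball far from the bounded set \<open>\<Omega>\<close>, where
  \<open>\<phi>\<close> is 0.\<close>

lemma gagliardo_zero_imp_zero:
  fixes \<phi> :: "'a::euclidean_space \<Rightarrow> real"
  assumes bd: "bounded \<Omega>" and 0: "\<And>x. x \<notin> \<Omega> \<Longrightarrow> \<phi> x = 0"
    and int: "integrable (lborel \<Otimes>\<^sub>M lborel) (gagliardo s \<phi> \<phi>)"
    and le: "(\<integral>p. gagliardo s \<phi> \<phi> p \<partial>(lborel \<Otimes>\<^sub>M lborel)) \<le> 0"
  shows "AE x in lborel. \<phi> x = 0"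
proof -
  have nn: "0 \<le> gagliardo s \<phi> \<phi> p" for p by (auto simp: gagliardo_def case_prod_beta)
  have "(\<integral>p. gagliardo s \<phi> \<phi> p \<partial>(lborel \<Otimes>\<^sub>M lborel)) = 0"
    using le nn by (intro antisym integral_nonneg_AE) auto
  then have "AE p in lborel \<Otimes>\<^sub>M lborel. gagliardo s \<phi> \<phi> p = 0"
    using int nn by (subst (asm) integral_nonneg_eq_0_iff_AE) auto
  from lborel_pair.AE_pair[OF this]
  have ae: "AE x in lborel. AE y in lborel. gagliardo s \<phi> \<phi> (x, y) = 0" .
  obtain B where B: "\<And>x. x \<in> \<Omega> \<Longrightarrow> norm x \<le> B" using bd by (auto simp: bounded_iff)
  obtain b :: 'a where b: "b \<in> Basis" using nonempty_Basis by blast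
  \<comment> \<open>Every point of the unit ball around \<open>c\<close> has norm above
    \<open>\<bar>B\<bar> + 1\<close>, hence lies outside \<open>\<Omega>\<close>.\<close>
  define c where "c = (\<bar>B\<bar> + 2) *\<^sub>R b"
  have out: "y \<notin> \<Omega>" if "y \<in> ball c 1" for y
  proof
    assume "y \<in> \<Omega>"
    then have "norm y \<le> B" by (rule B)
    moreover have "norm c = \<bar>B\<bar> + 2" using b by (simp add: c_def)
    moreover have "norm c \<le> norm y + dist c y" by (metis dist_norm norm_triangle_sub)
    ultimately show False using that by simp
  qed
  show ?thesis
    using ae
  proof (rule eventually_mono)
    fix x assume "AE y in lborel. gagliardo s \<phi> \<phi> (x, y) = 0"
    \<comment> \<open>For \<open>y = x\<close> the integrand is trivially 0 and says nothing about
      \<open>\<phi> x\<close>.\<close>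
    then have "AE y in lborel. gagliardo s \<phi> \<phi> (x, y) = 0 \<and> y \<noteq> x"
      using AE_lborel_singleton[of x] by eventually_elim simp
    from AE_lborel_open_Bex[OF this open_ball, of c c 1]
    obtain y where "y \<in> ball c 1" "gagliardo s \<phi> \<phi> (x, y) = 0" "y \<noteq> x" by auto
    then show "\<phi> x = 0" using 0[OF out] by (simp add: gagliardo_def)
  qed
qed

text \<open>Weak maximum principle: testing with the positive part \<open>\<phi>\<close> of
  \<open>u - b * barrier A\<close> shows that \<open>\<phi>\<close> has energy at most 0, hence
  vanishes almost everywhere.\<close>

lemma frac_weak_solution_le:
  fixes u f :: "'a::euclidean_space \<Rightarrow> real"
  assumes N: "DIM('a) \<ge> 2" and s: "0 < s" "s < 1"
    and A: "A \<ge> 2" and \<Omega>: "\<Omega> \<subseteq> cball 0 (A / 2)"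
    and \<kappa>: "\<kappa> > 0" "frac_c DIM('a) s * levy_mass DIM('a) s \<ge> \<kappa>"
    and m: "m \<ge> 0" "\<And>x. f x \<le> m"
    and sol: "frac_weak_solution s \<Omega> f u"
  shows "AE x in lborel. u x \<le> m / \<kappa> * A\<^sup>2"
proof -
  define c where "c = frac_c DIM('a) s"
  have c: "c > 0" unfolding c_def by (rule frac_c_pos[OF s])
  define J where "J = levy_mass DIM('a) s"
  let ?w = "barrier A :: 'a \<Rightarrow> real" and ?M = "lborel \<Otimes>\<^sub>M lborel :: ('a \<times> 'a) measure"
  \<comment> \<open>With this choice \<open>b * (c * J) \<ge> m\<close>, so the multiple of the
    barrier dominates the source.\<close>
  define b where "b = m / \<kappa>"
  have b: "b \<ge> 0" using m \<kappa> by (simp add: b_def)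
  have u: "u \<in> borel_measurable lborel" "\<And>x. x \<notin> \<Omega> \<Longrightarrow> u x = 0" "integrable lborel (\<lambda>x. (u x)\<^sup>2)"
    "integrable ?M (gagliardo s u u)"
    and test: "\<And>\<phi>. frac_space s \<Omega> \<phi> \<Longrightarrow> c / 2 * (\<integral>p. gagliardo s u \<phi> p \<partial>?M) = (\<integral>x. f x * \<phi> x \<partial>lborel)"
    using sol unfolding frac_weak_solution_def frac_space_iff_gagliardo c_def
    by (auto simp: gagliardo_def)
  have [measurable]: "u \<in> borel_measurable borel" using u(1) by simp
  have w: "integrable ?M (gagliardo s ?w ?w)"
    using A by (intro integrable_gagliardo_barrier N s) auto
  define v where "v x = u x - b * ?w x" for x
  define \<phi> where "\<phi> x = max 0 (v x)" for x
  have [measurable]: "v \<in> borel_measurable borel" "\<phi> \<in> borel_measurable borel"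
    unfolding v_def[abs_def] \<phi>_def[abs_def] by measurable
  have bw: "b * ?w x \<ge> 0" for x using b barrier_nonneg[of A x] by simp
  have \<phi>0: "\<phi> x \<ge> 0" for x by (simp add: \<phi>_def)
  \<comment> \<open>The barrier may be positive outside \<open>\<Omega>\<close>, but there
    \<open>u = 0\<close>, so the positive part vanishes and \<open>\<phi>\<close> is
    admissible.\<close>
  have \<phi>out: "\<phi> x = 0" if "x \<notin> \<Omega>" for x
    using u(2)[OF that] bw[of x] by (simp add: \<phi>_def v_def)
  have \<phi>u: "\<phi> x \<le> \<bar>u x\<bar>" for x using bw[of x] by (simp add: \<phi>_def v_def)
  have sq: "integrable lborel (\<lambda>x. (\<phi> x)\<^sup>2)"
  proof (rule Bochner_Integration.integrable_bound[OF u(3)])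
    have "(\<phi> x)\<^sup>2 \<le> (u x)\<^sup>2" for x using power_mono[OF \<phi>u \<phi>0, of x 2] by simp
    then show "AE x in lborel. norm ((\<phi> x)\<^sup>2) \<le> norm ((u x)\<^sup>2)" by simp
  qed measurable
  have gv: "integrable ?M (gagliardo s \<phi> \<phi>)"
  proof (rule Bochner_Integration.integrable_bound)
    show "integrable ?M (\<lambda>p. 2 * gagliardo s u u p + 2 * b\<^sup>2 * gagliardo s ?w ?w p)"
      using u(4) w by simp
    have "gagliardo s \<phi> \<phi> p \<le> 2 * gagliardo s u u p + 2 * b\<^sup>2 * gagliardo s ?w ?w p" for p
    proof -
      obtain x y where p: "p = (x, y)" by (cases p)
      have "\<bar>\<phi> x - \<phi> y\<bar>\<^sup>2 \<le> \<bar>v x - v y\<bar>\<^sup>2"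
        by (intro power_mono) (auto simp: \<phi>_def)
      also have "\<bar>v x - v y\<bar>\<^sup>2 = ((u x - u y) - b * (?w x - ?w y))\<^sup>2"
        by (simp add: v_def algebra_simps)
      also have "\<dots> \<le> 2 * (u x - u y)\<^sup>2 + 2 * (b * (?w x - ?w y))\<^sup>2"
        using zero_le_power2[of "(u x - u y) + b * (?w x - ?w y)"]
        by (simp add: power2_sum power2_diff)
      finally have "(\<phi> x - \<phi> y) * (\<phi> x - \<phi> y) \<le> 2 * ((u x - u y) * (u x - u y)) + 2 * b\<^sup>2 * ((?w x - ?w y) * (?w x - ?w y))"
        unfolding power2_abs power_mult_distrib by (simp only: power2_eq_square mult.assoc)
      from divide_right_mono[OF this, of "norm (x - y) powr (real DIM('a) + 2 * s)"]
      show ?thesis by (simp add: p gagliardo_def add_divide_distrib)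
    qed
    moreover have "0 \<le> gagliardo s \<phi> \<phi> p" for p by (auto simp: gagliardo_def case_prod_beta)
    ultimately show "AE p in ?M. norm (gagliardo s \<phi> \<phi> p) \<le> norm (2 * gagliardo s u u p + 2 * b\<^sup>2 * gagliardo s ?w ?w p)"
      by (intro AE_I2 norm_mono_nonneg)
  qed measurable
  have "frac_space s \<Omega> \<phi>"
    using \<phi>out sq gv by (simp add: frac_space_iff_gagliardo)
  note test = test[OF this]
  \<comment> \<open>Square integrability suffices because \<open>\<phi>\<close> lives on a bounded
    set and \<open>\<phi> x \<le> (\<phi> x)\<^sup>2 + 1\<close>.\<close>
  have \<phi>int: "integrable lborel \<phi>"
  proof (rule Bochner_Integration.integrable_bound)
    show "integrable lborel (\<lambda>x. (\<phi> x)\<^sup>2 + indicator (cball 0 A) x)"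
      using sq A by (intro Bochner_Integration.integrable_add integrable_real_indicator) (auto simp: emeasure_cball)
    have "\<phi> x \<le> (\<phi> x)\<^sup>2 + indicator (cball 0 A) x" for x
    proof (cases "x \<in> \<Omega>")
      case True
      then have "x \<in> cball 0 A" using subsetD[OF \<Omega> True] A by simp
      moreover have "\<phi> x \<le> (\<phi> x)\<^sup>2 + 1"
        using zero_le_power2[of "\<phi> x - 1/2"] by (simp add: power2_diff power_divide)
      ultimately show ?thesis by simp
    qed (simp add: \<phi>out)
    then show "AE x in lborel. norm (\<phi> x) \<le> norm ((\<phi> x)\<^sup>2 + indicator (cball 0 A) x)"
      using \<phi>0 by (intro AE_I2 norm_mono_nonneg)
  qed measurable
  have gu: "integrable ?M (gagliardo s u \<phi>)"
    by (rule integrable_gagliardo) (use u(4) gv in measurable)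
  have gw: "integrable ?M (gagliardo s ?w \<phi>)"
    by (rule integrable_gagliardo) (use w gv in measurable)
  have I0: "(\<integral>x. \<phi> x \<partial>lborel) \<ge> 0" using \<phi>0 by (intro integral_nonneg_AE) auto
  \<comment> \<open>Only the majorant \<open>m * \<phi> x\<close> has to be integrable: it is
    nonnegative, and a non-integrable left side would have integral 0.\<close>
  have "c / 2 * (\<integral>p. gagliardo s u \<phi> p \<partial>?M) \<le> (\<integral>x. m * \<phi> x \<partial>lborel)"
    unfolding test using \<phi>int m \<phi>0 by (intro integral_mono') (auto intro: mult_right_mono)
  then have E1: "c / 2 * (\<integral>p. gagliardo s u \<phi> p \<partial>?M) \<le> m * (\<integral>x. \<phi> x \<partial>lborel)" by simp
  have E2: "2 * J * (\<integral>x. \<phi> x \<partial>lborel) \<le> (\<integral>p. gagliardo s ?w \<phi> p \<partial>?M)"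
    unfolding J_def
  proof (rule gagliardo_lower_bound[OF N s _ _ \<phi>int \<phi>0 \<phi>out _ gw])
    show "\<bar>?w x\<bar> \<le> A\<^sup>2" for x using barrier_nonneg[of A x] barrier_le[of A x] by simp
    show "2 * min ((norm h)\<^sup>2) 1 \<le> 2 * ?w x - ?w (x + h) - ?w (x - h)" if "x \<in> \<Omega>" for x h
      using that \<Omega> by (intro barrier_second_difference A) auto
  qed measurable
  have "(\<integral>p. gagliardo s \<phi> \<phi> p \<partial>?M) \<le> (\<integral>p. gagliardo s u \<phi> p - b * gagliardo s ?w \<phi> p \<partial>?M)"
  proof (rule integral_mono[OF gv])
    show "integrable ?M (\<lambda>p. gagliardo s u \<phi> p - b * gagliardo s ?w \<phi> p)"
      using gu gw by simp
    fix p :: "'a \<times> 'a"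
    obtain x y where p: "p = (x, y)" by (cases p)
    \<comment> \<open>The positive part is monotone and 1-Lipschitz, so its increment has the sign
      of that of \<open>v\<close>, or is 0, and is no larger in modulus.\<close>
    have "(\<phi> x - \<phi> y) * (\<phi> x - \<phi> y) \<le> (v x - v y) * (\<phi> x - \<phi> y)"
    proof (cases "\<phi> x \<ge> \<phi> y")
      case True
      then have "\<phi> x - \<phi> y \<le> v x - v y \<or> \<phi> x = \<phi> y" by (auto simp: \<phi>_def)
      then show ?thesis using True by (auto intro: mult_right_mono)
    next
      case False
      then have "\<phi> x - \<phi> y \<ge> v x - v y" by (auto simp: \<phi>_def)
      then show ?thesis using False by (auto intro: mult_right_mono_neg)
    qed
    also have "\<dots> = (u x - u y) * (\<phi> x - \<phi> y) - b * ((?w x - ?w y) * (\<phi> x - \<phi> y))"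
      by (simp add: v_def algebra_simps)
    finally have "(\<phi> x - \<phi> y) * (\<phi> x - \<phi> y) \<le> (u x - u y) * (\<phi> x - \<phi> y) - b * ((?w x - ?w y) * (\<phi> x - \<phi> y))" .
    from divide_right_mono[OF this, of "norm (x - y) powr (real DIM('a) + 2 * s)"]
    show "gagliardo s \<phi> \<phi> p \<le> gagliardo s u \<phi> p - b * gagliardo s ?w \<phi> p"
      by (simp add: p gagliardo_def diff_divide_distrib)
  qed
  also have "\<dots> = (\<integral>p. gagliardo s u \<phi> p \<partial>?M) - b * (\<integral>p. gagliardo s ?w \<phi> p \<partial>?M)"
    using gu gw by simp
  also have "\<dots> \<le> 2 / c * (m * (\<integral>x. \<phi> x \<partial>lborel)) - b * (2 * J * (\<integral>x. \<phi> x \<partial>lborel))"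
    using E1 c mult_left_mono[OF E2 b] by (intro diff_mono) (auto simp: field_simps)
  also have "\<dots> = 2 / c * (\<integral>x. \<phi> x \<partial>lborel) * (m - b * (c * J))"
    using c by (simp add: field_simps)
  also have "\<dots> \<le> 0"
  proof -
    have "b * \<kappa> \<le> b * (c * J)" using \<kappa>(2) b unfolding c_def J_def by (rule mult_left_mono)
    then have "m - b * (c * J) \<le> 0" using \<kappa>(1) by (simp add: b_def)
    then show ?thesis using c I0 by (intro mult_nonneg_nonpos) auto
  qed
  finally have "AE x in lborel. \<phi> x = 0"
    using \<Omega> by (intro gagliardo_zero_imp_zero[of \<Omega> \<phi> s] gv \<phi>out) (auto intro: bounded_subset bounded_cball)
  then show ?thesis
  proof (rule eventually_mono)
    fix x assume "\<phi> x = 0"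
    then have "u x \<le> b * ?w x" by (simp add: \<phi>_def v_def max_def split: if_splits)
    also have "\<dots> \<le> b * A\<^sup>2" using b barrier_le by (intro mult_left_mono) auto
    finally show "u x \<le> m / \<kappa> * A\<^sup>2" by (simp add: b_def)
  qed
qed

section \<open>The Green function\<close>

text \<open>Membership in C_c(\<Omega>), phrased exactly as the class of sources in
  \<open>frac_green\<close>.\<close>

definition test_function :: "'a::euclidean_space set \<Rightarrow> ('a \<Rightarrow> real) \<Rightarrow> bool" where
  "test_function \<Omega> f \<longleftrightarrow>
     continuous_on UNIV f \<and> compact (closure {x. f x \<noteq> 0}) \<and> closure {x. f x \<noteq> 0} \<subseteq> \<Omega>"

lemma test_functionI:
  assumes "continuous_on UNIV f" "\<And>x. f x \<noteq> 0 \<Longrightarrow> x \<in> K" "closed K" "K \<subseteq> \<Omega>" "bounded \<Omega>"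
  shows "test_function \<Omega> f"
proof -
  have "closure {x. f x \<noteq> 0} \<subseteq> K" using assms by (intro closure_minimal) auto
  moreover have "compact K" using assms by (auto simp: compact_eq_bounded_closed intro: bounded_subset)
  ultimately show ?thesis
    using assms unfolding test_function_def
    by (auto simp: compact_eq_bounded_closed intro: bounded_subset)
qed

text \<open>Turns the upper bound of the comparison principle into a lower bound.\<close>

lemma frac_weak_solution_uminus:
  fixes u f :: "'a::euclidean_space \<Rightarrow> real"
  assumes "frac_weak_solution s \<Omega> f u"
  shows "frac_weak_solution s \<Omega> (\<lambda>x. - f x) (\<lambda>x. - u x)"
proof -
  have g: "gagliardo s (\<lambda>x. - u x) (\<lambda>x. - u x) = gagliardo s u u"
    by (auto simp: gagliardo_def fun_eq_iff) (simp add: algebra_simps)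
  have g': "(\<lambda>p. case p of (x, y) \<Rightarrow> (- u x - - u y) * (\<phi> x - \<phi> y) / norm (x - y) powr (real DIM('a) + 2 * s))
      = (\<lambda>p. - (case p of (x, y) \<Rightarrow> (u x - u y) * (\<phi> x - \<phi> y) / norm (x - y) powr (real DIM('a) + 2 * s)))" for \<phi>
    by (auto simp: fun_eq_iff divide_simps) (simp add: algebra_simps)
  show ?thesis
    using assms unfolding frac_weak_solution_def frac_space_iff_gagliardo g g'
    by (auto simp: borel_measurable_uminus)
qed

lemma green_outside:
  assumes "frac_green s \<Omega> G" "x \<notin> \<Omega> \<or> z \<notin> \<Omega>"
  shows "G x z = 0"
  using assms unfolding frac_green_def by blast

lemma green_integrable:
  assumes "frac_green s \<Omega> G"
  shows "integrable lborel (G x)"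
proof (cases "x \<in> \<Omega>")
  case True
  then have "integrable lborel (\<lambda>z. indicator \<Omega> z *\<^sub>R G x z)"
    using assms by (auto simp: frac_green_def set_integrable_def)
  moreover have "(\<lambda>z. indicator \<Omega> z *\<^sub>R G x z) = G x"
    using assms by (auto simp: frac_green_def indicator_def fun_eq_iff)
  ultimately show ?thesis by simp
next
  case False
  then have "G x = (\<lambda>z. 0)" using assms by (auto simp: frac_green_def)
  then show ?thesis by simp
qed

lemma green_mult_integrable:
  assumes G: "frac_green s \<Omega> G" and [measurable]: "f \<in> borel_measurable borel"
    and B: "\<And>z. z \<in> \<Omega> \<Longrightarrow> \<bar>f z\<bar> \<le> B"
  shows "integrable lborel (\<lambda>z. G x z * f z)"
proof (rule Bochner_Integration.integrable_bound)
  show "integrable lborel (\<lambda>z. B * G x z)" using green_integrable[OF G] by simp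
  have [measurable]: "G x \<in> borel_measurable borel"
    using green_integrable[OF G, of x] by (auto dest: borel_measurable_integrable)
  show "(\<lambda>z. G x z * f z) \<in> borel_measurable lborel" by measurable
  have "\<bar>G x z * f z\<bar> \<le> \<bar>B * G x z\<bar>" for z
  proof (cases "z \<in> \<Omega>")
    case True
    then have "\<bar>f z\<bar> \<le> \<bar>B\<bar>" using B[of z] by linarith
    then show ?thesis by (simp add: abs_mult mult.commute mult_right_mono)
  next
    case False
    then show ?thesis using G by (simp add: frac_green_def)
  qed
  then show "AE z in lborel. norm (G x z * f z) \<le> norm (B * G x z)" by simp
qed

lemma green_potential:
  assumes "frac_green s \<Omega> G" "test_function \<Omega> f"
  shows "frac_weak_solution s \<Omega> f (\<lambda>x. \<integral>z. G x z * f z \<partial>lborel)"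
  using assms unfolding frac_green_def test_function_def by blast

lemma bounded_subset_cball_half:
  assumes "bounded (\<Omega> :: 'a::euclidean_space set)"
  obtains A :: real where "A \<ge> 2" "\<Omega> \<subseteq> cball 0 (A / 2)"
proof -
  obtain B where "\<And>x. x \<in> \<Omega> \<Longrightarrow> norm x \<le> B" using assms by (auto simp: bounded_iff)
  then show ?thesis by (intro that[of "2 * \<bar>B\<bar> + 2"]) fastforce+
qed

lemma open_off_diagonal:
  fixes \<Omega> :: "'a::euclidean_space set"
  assumes "open \<Omega>"
  shows "open {p. fst p \<in> \<Omega> \<and> snd p \<in> \<Omega> \<and> fst p \<noteq> snd p}"
proof -
  have "open (\<Omega> \<times> \<Omega> \<inter> {p::'a \<times> 'a. fst p \<noteq> snd p})"
    using assms by (intro open_Int open_Times open_Collect_neq continuous_intros)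
  moreover have "\<Omega> \<times> \<Omega> \<inter> {p::'a \<times> 'a. fst p \<noteq> snd p} = {p. fst p \<in> \<Omega> \<and> snd p \<in> \<Omega> \<and> fst p \<noteq> snd p}"
    by auto
  ultimately show ?thesis by simp
qed

text \<open>A negative value persists on a product neighbourhood \<open>U \<times> V\<close>. A bump
  supported in \<open>V\<close> then has a strictly negative potential on \<open>U\<close>, against
  the comparison principle with \<open>m = 0\<close>. The diagonal is excluded because
  \<open>frac_green\<close> does not constrain the values there.\<close>

lemma green_nonneg:
  fixes \<Omega> :: "'a::euclidean_space set"
  assumes N: "DIM('a) \<ge> 2" and s: "0 < s" "s < 1" and \<Omega>: "open \<Omega>" "bounded \<Omega>"
    and G: "frac_green s \<Omega> G" and x: "x \<noteq> z"
  shows "G x z \<ge> 0"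
proof (rule ccontr)
  assume neg: "\<not> G x z \<ge> 0"
  then have xz: "x \<in> \<Omega>" "z \<in> \<Omega>" using green_outside[OF G, of x z] by auto
  let ?D = "{p. fst p \<in> \<Omega> \<and> snd p \<in> \<Omega> \<and> fst p \<noteq> snd p}"
  have cont: "continuous_on ?D (\<lambda>p. G (fst p) (snd p))" using G by (simp add: frac_green_def)
  have "open (?D \<inter> (\<lambda>p. G (fst p) (snd p)) -` {..<0})"
    by (intro continuous_open_preimage[OF cont open_off_diagonal] \<Omega>) simp
  moreover have "(x, z) \<in> ?D \<inter> (\<lambda>p. G (fst p) (snd p)) -` {..<0}"
    using xz x neg by simp
  ultimately obtain U V where UV: "open U" "open V" "x \<in> U" "z \<in> V"
    "U \<times> V \<subseteq> ?D \<inter> (\<lambda>p. G (fst p) (snd p)) -` {..<0}"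
    by (rule open_prod_elim) auto
  obtain r where r: "r > 0" "cball z r \<subseteq> V" using UV(2,4) open_contains_cball by blast
  have V\<Omega>: "V \<subseteq> \<Omega>" using UV(3,5) by auto
  \<comment> \<open>A tent that is positive exactly on \<open>ball z r\<close> and whose support
    stays inside \<open>V\<close>.\<close>
  define f where "f y = max 0 (r - dist y z)" for y
  have fc: "continuous_on UNIV f" unfolding f_def by (intro continuous_intros)
  have test: "test_function \<Omega> f"
    using fc by (rule test_functionI[where K="cball z r"])
       (use r V\<Omega> \<Omega>(2) in \<open>auto simp: f_def dist_commute split: if_splits\<close>)
  have [measurable]: "f \<in> borel_measurable borel" using fc by (rule borel_measurable_continuous_onI)
  obtain A where A: "A \<ge> 2" "\<Omega> \<subseteq> cball 0 (A / 2)" using bounded_subset_cball_half[OF \<Omega>(2)] by blast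
  obtain \<kappa> where \<kappa>: "\<kappa> > 0" "frac_c DIM('a) s * levy_mass DIM('a) s \<ge> \<kappa>"
    using frac_c_levy_mass_lower[OF N] s by metis
  have "AE x in lborel. - (\<integral>y. G x y * f y \<partial>lborel) \<le> 0 / \<kappa> * A\<^sup>2"
    by (rule frac_weak_solution_le[OF N s A \<kappa> _ _ frac_weak_solution_uminus[OF green_potential[OF G test]]])
       (auto simp: f_def)
  \<comment> \<open>Comparison holds only almost everywhere, so \<open>x\<close> is replaced by a
    nearby good point of \<open>U\<close>.\<close>
  then obtain x' where x': "x' \<in> U" "(\<integral>y. G x' y * f y \<partial>lborel) \<ge> 0"
    using AE_lborel_open_Bex[OF _ UV(1,3)] by fastforce
  have Gneg: "G x' y < 0" if "y \<in> ball z r" for y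
    using that r(2) x'(1) UV(5) by (force simp: subset_iff)
  have int: "integrable lborel (\<lambda>y. G x' y * f y)"
    by (rule green_mult_integrable[OF G, of _ r]) (use r(1) in \<open>auto simp: f_def\<close>)
  have nn: "0 \<le> - (G x' y * f y)" for y
    using Gneg[of y] by (cases "y \<in> ball z r") (auto simp: f_def dist_commute mult_le_0_iff)
  have "(\<integral>y. - (G x' y * f y) \<partial>lborel) = 0"
    using x'(2) nn by (intro antisym integral_nonneg_AE) (auto)
  then have "AE y in lborel. - (G x' y * f y) = 0"
    using int nn by (subst (asm) integral_nonneg_eq_0_iff_AE) auto
  then obtain y where "y \<in> ball z r" "G x' y * f y = 0"
    using AE_lborel_open_Bex[OF _ open_ball, of _ z z r] r(1) by fastforce
  then show False using Gneg[of y] by (auto simp: f_def dist_commute)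
qed

lemma green_AE_nonneg:
  fixes \<Omega> :: "'a::euclidean_space set"
  assumes "DIM('a) \<ge> 2" "0 < s" "s < 1" "open \<Omega>" "bounded \<Omega>" "frac_green s \<Omega> G"
  shows "AE z in lborel. G x z \<ge> 0"
  using AE_lborel_singleton[of x] by (rule eventually_mono) (rule green_nonneg[OF assms], auto)

text \<open>
  The comparison bound holds only for almost every \<open>x\<close>; Fatou's lemma along good points
  converging to \<open>x\<close> extends it to every \<open>x\<close>, because \<open>G\<close> is nonnegative and continuous off the
  diagonal.
\<close>
lemma green_integral_le:
  fixes \<Omega> :: "'a::euclidean_space set"
  assumes N: "DIM('a) \<ge> 2" and s: "0 < s" "s < 1" and \<Omega>: "open \<Omega>" "bounded \<Omega>"
    and G: "frac_green s \<Omega> G"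
    and A: "A \<ge> 2" "\<Omega> \<subseteq> cball 0 (A / 2)"
    and \<kappa>: "\<kappa> > 0" "frac_c DIM('a) s * levy_mass DIM('a) s \<ge> \<kappa>"
    and x: "x \<in> \<Omega>"
  shows "(\<integral>z. G x z \<partial>lborel) \<le> A\<^sup>2 / \<kappa>"
proof -
  define B where "B = A\<^sup>2 / \<kappa>"
  have B: "B \<ge> 0" using \<kappa> by (simp add: B_def)
  \<comment> \<open>Continuous cut-offs: 0 up to distance \<open>1 / Suc n\<close> from the
    complement of \<open>\<Omega>\<close>, and 1 from distance \<open>2 / Suc n\<close> on.\<close>
  define f where "f n y = min 1 (max 0 (real (Suc n) * infdist y (- \<Omega>) - 1))" for n y
  have fc: "continuous_on UNIV (f n)" for n unfolding f_def by (intro continuous_intros)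
  have fm [measurable]: "f n \<in> borel_measurable borel" for n
    using fc by (rule borel_measurable_continuous_onI)
  have f01: "0 \<le> f n y" "f n y \<le> 1" for n y by (auto simp: f_def)
  have test: "test_function \<Omega> (f n)" for n
  proof (rule test_functionI[OF fc])
    show "y \<in> {y. infdist y (- \<Omega>) \<ge> 1 / real (Suc n)}" if "f n y \<noteq> 0" for y
      using that by (auto simp: f_def field_simps split: if_splits)
    show "closed {y. infdist y (- \<Omega>) \<ge> 1 / real (Suc n)}"
      by (intro closed_Collect_le continuous_intros)
    show "{y. infdist y (- \<Omega>) \<ge> 1 / real (Suc n)} \<subseteq> \<Omega>"
    proof
      fix y assume "y \<in> {y. infdist y (- \<Omega>) \<ge> 1 / real (Suc n)}"
      moreover have "1 / real (Suc n) > 0" by simp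
      ultimately have "infdist y (- \<Omega>) \<noteq> 0" by (metis mem_Collect_eq not_le)
      then show "y \<in> \<Omega>" by (metis ComplI infdist_zero)
    qed
  qed fact
  have flim: "(\<lambda>n. f n y) \<longlonglongrightarrow> 1" if y: "y \<in> \<Omega>" for y
  proof -
    \<comment> \<open>The distance to an empty set is 0 by convention, so the complement must be
      nonempty.\<close>
    have "- \<Omega> \<noteq> {}" using \<Omega>(2) not_bounded_UNIV by (metis Compl_empty_eq double_compl)
    then have d: "infdist y (- \<Omega>) > 0"
      using \<Omega>(1) y by (intro infdist_pos_not_in_closed) auto
    have "eventually (\<lambda>n. inverse (real (Suc n)) < infdist y (- \<Omega>) / 2) sequentially"
      using d by (intro order_tendstoD(2)[OF LIMSEQ_inverse_real_of_nat]) auto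
    then have "eventually (\<lambda>n. f n y = 1) sequentially"
    proof (rule eventually_mono)
      fix n assume "inverse (real (Suc n)) < infdist y (- \<Omega>) / 2"
      then have "2 < real (Suc n) * infdist y (- \<Omega>)" by (simp add: field_simps)
      then show "f n y = 1" by (simp add: f_def)
    qed
    then show ?thesis by (rule tendsto_eventually)
  qed
  have "AE x in lborel. (\<integral>z. G x z * f n z \<partial>lborel) \<le> 1 / \<kappa> * A\<^sup>2" for n
    by (rule frac_weak_solution_le[OF N s A \<kappa> _ _ green_potential[OF G test]]) (use f01 in auto)
  \<comment> \<open>A single null set serves all \<open>n\<close>, so the limit in \<open>n\<close>
    can be taken at each good point.\<close>
  then have "AE x in lborel. \<forall>n. (\<integral>z. G x z * f n z \<partial>lborel) \<le> B"
    by (simp add: AE_all_countable B_def)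
  then have good: "AE x in lborel. (\<integral>z. G x z \<partial>lborel) \<le> B"
  proof (rule eventually_mono)
    fix x assume le: "\<forall>n. (\<integral>z. G x z * f n z \<partial>lborel) \<le> B"
    have [measurable]: "G x \<in> borel_measurable borel"
      using green_integrable[OF G, of x] by (auto dest: borel_measurable_integrable)
    have "(\<lambda>n. \<integral>z. G x z * f n z \<partial>lborel) \<longlonglongrightarrow> (\<integral>z. G x z \<partial>lborel)"
    proof (rule integral_dominated_convergence[OF _ _ integrable_norm[OF green_integrable[OF G, of x]]])
      show "AE z in lborel. (\<lambda>n. G x z * f n z) \<longlonglongrightarrow> G x z"
      proof (rule AE_I2)
        fix z show "(\<lambda>n. G x z * f n z) \<longlonglongrightarrow> G x z"
        proof (cases "z \<in> \<Omega>")
          case True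
          from tendsto_mult_left[OF flim[OF True], of "G x z"] show ?thesis by simp
        next
          case False
          then show ?thesis using G by (simp add: frac_green_def)
        qed
      qed
      show "AE z in lborel. norm (G x z * f n z) \<le> norm (G x z)" for n
        using f01 by (simp add: abs_mult mult_left_le)
    qed measurable
    then show "(\<integral>z. G x z \<partial>lborel) \<le> B"
      by (rule LIMSEQ_le_const2) (use le in auto)
  qed
  have "\<exists>y \<in> ball x (inverse (real (Suc k))) \<inter> \<Omega>. (\<integral>z. G y z \<partial>lborel) \<le> B" for k
    using AE_lborel_open_Bex[OF good, of "ball x (inverse (real (Suc k))) \<inter> \<Omega>" x] \<Omega>(1) x by auto
  then obtain X where X: "\<And>k. X k \<in> ball x (inverse (real (Suc k)))" "\<And>k. X k \<in> \<Omega>"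
    "\<And>k. (\<integral>z. G (X k) z \<partial>lborel) \<le> B"
    by (metis IntE)
  have Xlim: "X \<longlonglongrightarrow> x"
  proof (rule metric_tendsto_imp_tendsto[OF LIMSEQ_inverse_real_of_nat])
    show "\<forall>\<^sub>F k in sequentially. dist (X k) x \<le> dist (inverse (real (Suc k))) 0"
      using X(1) by (intro always_eventually allI) (simp add: dist_commute less_imp_le)
  qed
  have Gm [measurable]: "G y \<in> borel_measurable borel" for y
    using green_integrable[OF G, of y] by (auto dest: borel_measurable_integrable)
  have nn: "ennreal (\<integral>z. G y z \<partial>lborel) = (\<integral>\<^sup>+z. ennreal (G y z) \<partial>lborel)" for y
    by (intro nn_integral_eq_integral[symmetric] green_integrable[OF G] green_AE_nonneg[OF N s \<Omega> G])
  have Glim: "(\<lambda>k. G (X k) z) \<longlonglongrightarrow> G x z" if "z \<noteq> x" for z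
  proof (cases "z \<in> \<Omega>")
    case True
    let ?D = "{p. fst p \<in> \<Omega> \<and> snd p \<in> \<Omega> \<and> fst p \<noteq> snd p}"
    have "continuous_on ?D (\<lambda>p. G (fst p) (snd p))" using G by (simp add: frac_green_def)
    then have "isCont (\<lambda>p. G (fst p) (snd p)) (x, z)"
      using that x True open_off_diagonal[OF \<Omega>(1)] by (subst (asm) continuous_on_eq_continuous_at) auto
    then have "(\<lambda>k. (\<lambda>p. G (fst p) (snd p)) (X k, z)) \<longlonglongrightarrow> (\<lambda>p. G (fst p) (snd p)) (x, z)"
      by (rule isCont_tendsto_compose) (intro tendsto_intros Xlim)
    then show ?thesis by simp
  next
    case False
    then show ?thesis using G by (simp add: frac_green_def)
  qed
  have "(\<integral>\<^sup>+z. ennreal (G x z) \<partial>lborel) = (\<integral>\<^sup>+z. liminf (\<lambda>k. ennreal (G (X k) z)) \<partial>lborel)"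
  proof (intro nn_integral_cong_AE eventually_mono[OF AE_lborel_singleton[of x]])
    fix z assume "z \<noteq> x"
    then have "(\<lambda>k. ennreal (G (X k) z)) \<longlonglongrightarrow> ennreal (G x z)"
      by (intro tendsto_ennrealI Glim)
    then show "ennreal (G x z) = liminf (\<lambda>k. ennreal (G (X k) z))"
      by (simp add: lim_imp_Liminf)
  qed
  also have "\<dots> \<le> liminf (\<lambda>k. \<integral>\<^sup>+z. ennreal (G (X k) z) \<partial>lborel)"
    by (rule nn_integral_liminf) measurable
  also have "\<dots> \<le> liminf (\<lambda>k. ennreal B)"
    unfolding nn[symmetric] using X(3) B by (intro Liminf_mono always_eventually allI) (simp add: ennreal_leI)
  finally have "ennreal (\<integral>z. G x z \<partial>lborel) \<le> ennreal B"
    by (simp add: nn Liminf_const)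
  then show ?thesis using B by (simp add: ennreal_le_iff B_def)
qed

section \<open>Uniform limit of the rescaled Poisson kernel\<close>

text \<open>For \<open>0 \<le> p \<le> P\<close> the value \<open>t powr p\<close> lies between 1
  and \<open>t ^ P\<close>, so continuity of one power gives a \<open>\<delta>\<close> valid for all
  exponents. This is the source of uniformity in \<open>s\<close> for the kernel ratio.\<close>

lemma powr_near_one:
  fixes P :: nat and \<eta> :: real
  assumes "\<eta> > 0"
  obtains \<delta> where "\<delta> > 0" "\<And>p t. 0 \<le> p \<Longrightarrow> p \<le> real P \<Longrightarrow> t > 0 \<Longrightarrow> \<bar>t - 1\<bar> < \<delta> \<Longrightarrow> \<bar>t powr p - 1\<bar> < \<eta>"
proof -
  have "isCont (\<lambda>t::real. t ^ P) 1" by (intro continuous_intros)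
  then obtain \<delta> where \<delta>: "\<delta> > 0" "\<And>t::real. \<bar>t - 1\<bar> < \<delta> \<Longrightarrow> \<bar>t ^ P - 1\<bar> < \<eta>"
    using assms unfolding continuous_at_eps_delta by (auto simp: dist_real_def)
  show ?thesis
  proof (rule that[OF \<delta>(1)])
    fix p t :: real assume p: "0 \<le> p" "p \<le> real P" and t: "t > 0" "\<bar>t - 1\<bar> < \<delta>"
    have "\<bar>t powr real P - 1\<bar> < \<eta>" using \<delta>(2)[OF t(2)] t(1) by (simp add: powr_realpow)
    moreover have "1 \<le> t powr p \<and> t powr p \<le> t powr real P" if "t \<ge> 1"
      using that p by (auto intro: powr_mono ge_one_powr_ge_zero)
    moreover have "t powr real P \<le> t powr p \<and> t powr p \<le> 1" if "t \<le> 1"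
      using that p t(1) powr_mono'[of p "real P" t] powr_mono'[of 0 p t] by auto
    ultimately show "\<bar>t powr p - 1\<bar> < \<eta>" by linarith
  qed
qed

theorem theoremB2:
  fixes \<Omega> :: "'a::euclidean_space set" and G :: "real \<Rightarrow> 'a \<Rightarrow> 'a \<Rightarrow> real"
  assumes "DIM('a) \<ge> 2" and "open \<Omega>" and "bounded \<Omega>"
    and "\<forall>s\<in>{0<..<1}. frac_green s \<Omega> (G s)"
  shows "\<forall>\<epsilon>>0. \<exists>R. \<forall>s\<in>{0<..<1}. \<forall>x\<in>\<Omega>. \<forall>y. norm y \<ge> R \<longrightarrow>
           \<bar>norm y powr (real DIM('a) + 2 * s) / frac_c DIM('a) s * frac_poisson s \<Omega> (G s) x y
             - (LINT z:\<Omega>|lborel. G s x z)\<bar> < \<epsilon>"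
proof (intro allI impI)
  fix \<epsilon> :: real assume \<epsilon>: "\<epsilon> > 0"
  obtain A where A: "A \<ge> 2" "\<Omega> \<subseteq> cball 0 (A / 2)"
    using bounded_subset_cball_half[OF assms(3)] by blast
  obtain \<kappa> where \<kappa>: "\<kappa> > 0" "\<And>s. 0 < s \<Longrightarrow> s < 1 \<Longrightarrow> frac_c DIM('a) s * levy_mass DIM('a) s \<ge> \<kappa>"
    using frac_c_levy_mass_lower[OF assms(1)] by metis
  define B where "B = A\<^sup>2 / \<kappa>"
  have B: "B \<ge> 0" using \<kappa>(1) by (simp add: B_def)
  \<comment> \<open>The \<open>+ 1\<close> avoids division by 0 and makes the final inequality
    \<open>\<eta> * B < \<epsilon>\<close> strict.\<close>
  define \<eta> where "\<eta> = \<epsilon> / (B + 1)"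
  have \<eta>: "\<eta> > 0" using \<epsilon> B by (simp add: \<eta>_def)
  obtain \<delta> where \<delta>: "\<delta> > 0"
    "\<And>p t. 0 \<le> p \<Longrightarrow> p \<le> real (DIM('a) + 2) \<Longrightarrow> t > 0 \<Longrightarrow> \<bar>t - 1\<bar> < \<delta> \<Longrightarrow> \<bar>t powr p - 1\<bar> < \<eta>"
    using powr_near_one[OF \<eta>] by metis
  show "\<exists>R. \<forall>s\<in>{0<..<1}. \<forall>x\<in>\<Omega>. \<forall>y. norm y \<ge> R \<longrightarrow>
           \<bar>norm y powr (real DIM('a) + 2 * s) / frac_c DIM('a) s * frac_poisson s \<Omega> (G s) x y
             - (LINT z:\<Omega>|lborel. G s x z)\<bar> < \<epsilon>"
  proof (intro exI ballI allI impI)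
    \<comment> \<open>The witness is \<open>R = A + A / \<delta>\<close>: as
      \<open>norm z \<le> A / 2\<close>, it gives \<open>norm (z - y) > A / \<delta>\<close>, so the
      ratio of norms differs from 1 by less than \<open>\<delta>\<close>. It depends on neither
      \<open>s\<close> nor \<open>x\<close>.\<close>
    fix s :: real and x y :: 'a
    assume s01: "s \<in> {0<..<1}" and x: "x \<in> \<Omega>" and y: "norm y \<ge> A + A / \<delta>"
    then have s: "0 < s" "s < 1" by auto
    have G: "frac_green s \<Omega> (G s)" using assms(4) s01 by blast
    define p where "p = real DIM('a) + 2 * s"
    define r where "r z = norm y powr p / norm (z - y) powr p" for z
    have r1: "\<bar>r z - 1\<bar> \<le> \<eta>" if z: "z \<in> \<Omega>" for z
    proof -
      have zA: "norm z \<le> A / 2" using z A(2) by auto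
      have Ad: "A / \<delta> > 0" using A(1) \<delta>(1) by simp
      have zy: "norm (z - y) \<ge> norm y - norm z" "\<bar>norm y - norm (z - y)\<bar> \<le> norm z"
        using norm_triangle_ineq2[of y z] norm_triangle_ineq3[of y "y - z"]
        by (auto simp: norm_minus_commute)
      have pos: "norm (z - y) > A / \<delta>" using zy(1) zA y A(1) by linarith
      then have pos': "norm (z - y) > 0" using Ad by linarith
      have ypos: "norm y > 0" using y A(1) Ad by linarith
      have "\<bar>norm y / norm (z - y) - 1\<bar> = \<bar>norm y - norm (z - y)\<bar> / norm (z - y)"
        using pos' by (simp add: divide_simps)
      also have "\<dots> \<le> A / norm (z - y)" using zy(2) zA A(1) by (intro divide_right_mono) auto
      also have "\<dots> < \<delta>" using pos pos' \<delta>(1) by (simp add: field_simps)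
      finally have "\<bar>(norm y / norm (z - y)) powr p - 1\<bar> < \<eta>"
        using s ypos pos' by (intro \<delta>(2)) (auto simp: p_def)
      then show ?thesis by (simp add: r_def powr_divide)
    qed
    have [measurable]: "r \<in> borel_measurable borel" unfolding r_def by measurable
    have out: "G s x z = 0" if "z \<notin> \<Omega>" for z using G that by (simp add: frac_green_def)
    have i1: "(LINT z:\<Omega>|lborel. G s x z) = (\<integral>z. G s x z \<partial>lborel)"
      unfolding set_lebesgue_integral_def using out
      by (intro Bochner_Integration.integral_cong) (auto simp: indicator_def)
    have i2: "norm y powr p / frac_c DIM('a) s * frac_poisson s \<Omega> (G s) x y = (\<integral>z. G s x z * r z \<partial>lborel)"
    proof -
      have "norm y powr p / frac_c DIM('a) s * frac_poisson s \<Omega> (G s) x y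
          = norm y powr p * (LINT z:\<Omega>|lborel. G s x z / norm (z - y) powr p)"
        using frac_c_pos[OF s, of "DIM('a)"] by (simp add: frac_poisson_def p_def)
      also have "\<dots> = (\<integral>z. norm y powr p * (indicator \<Omega> z *\<^sub>R (G s x z / norm (z - y) powr p)) \<partial>lborel)"
        by (simp only: set_lebesgue_integral_def integral_mult_right_zero)
      also have "\<dots> = (\<integral>z. G s x z * r z \<partial>lborel)"
        using out by (intro Bochner_Integration.integral_cong) (auto simp: indicator_def r_def)
      finally show ?thesis .
    qed
    have Gint: "integrable lborel (G s x)" by (rule green_integrable[OF G])
    have Grint: "integrable lborel (\<lambda>z. G s x z * r z)"
    proof (rule green_mult_integrable[OF G])
      show "\<bar>r z\<bar> \<le> 1 + \<eta>" if "z \<in> \<Omega>" for z using r1[OF that] by linarith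
    qed measurable
    have "\<bar>(\<integral>z. G s x z * r z \<partial>lborel) - (\<integral>z. G s x z \<partial>lborel)\<bar> = \<bar>\<integral>z. G s x z * r z - G s x z \<partial>lborel\<bar>"
      using Gint Grint by simp
    also have "\<dots> \<le> (\<integral>z. \<bar>G s x z * r z - G s x z\<bar> \<partial>lborel)"
      by (rule integral_abs_bound)
    \<comment> \<open>Positivity of \<open>G\<close> lets the modulus be dropped, so the uniform
      bound on the integral of \<open>G s x\<close> controls the error. Outside
      \<open>\<Omega>\<close>, where \<open>r\<close> is not controlled, \<open>G\<close>
      vanishes.\<close>
    also have "\<dots> \<le> (\<integral>z. \<eta> * G s x z \<partial>lborel)"
    proof (rule integral_mono_AE)
      show "AE z in lborel. \<bar>G s x z * r z - G s x z\<bar> \<le> \<eta> * G s x z"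
        using green_AE_nonneg[OF assms(1) s assms(2,3) G, of x]
      proof (rule eventually_mono)
        fix z assume nn: "0 \<le> G s x z"
        have "G s x z * r z - G s x z = G s x z * (r z - 1)" by (simp add: algebra_simps)
        then have "\<bar>G s x z * r z - G s x z\<bar> = \<bar>r z - 1\<bar> * G s x z"
          using nn by (simp add: abs_mult)
        then show "\<bar>G s x z * r z - G s x z\<bar> \<le> \<eta> * G s x z"
          using r1[of z] out[of z] nn by (cases "z \<in> \<Omega>") (auto intro: mult_right_mono)
      qed
    qed (use Gint Grint in auto)
    also have "\<dots> = \<eta> * (\<integral>z. G s x z \<partial>lborel)" by simp
    also have "\<dots> \<le> \<eta> * B"
      unfolding B_def using \<eta>
      by (intro mult_left_mono green_integral_le[OF assms(1) s assms(2,3) G A \<kappa>(1) \<kappa>(2)[OF s] x]) auto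
    also have "\<dots> < \<epsilon>" using \<epsilon> B by (simp add: \<eta>_def field_simps)
    finally show "\<bar>norm y powr (real DIM('a) + 2 * s) / frac_c DIM('a) s * frac_poisson s \<Omega> (G s) x y
             - (LINT z:\<Omega>|lborel. G s x z)\<bar> < \<epsilon>"
      using i1 i2 by (simp add: p_def)
  qed
qed

end
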